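(* Let $R$ be a PVMD (Prüfer $v$-multiplication domain). Then $R$ is Clifford $t$-regular if and only if $R$ is a Krull-type domain (i.e., in a PVMD, Clifford $t$-regularity coincides with the finite $t$-character condition).
   Context: All rings are integral domains. Let $R$ be a domain with quotient field $K$. For fractional ideals $I,J$ of $R$, $(I:J)=\{x\in K : xJ\subseteq I\}$. For a nonzero fractional ideal $I$, put $I^{-1}=(R:I)$, $I_v=(I^{-1})^{-1}$, and $I_t=\bigcup J_v$, where $J$ ranges over the nonzero finitely generated fractional ideals contained in $I$. $I$ is a $t$-ideal if it is nonzero and $I_t=I$. A $t$-maximal ideal is a maximal element of the set of proper integral $t$-ideals of $R$. The fractional $t$-ideals form a commutative semigroup $F_t(R)$ under $(I,J)\mapsto (IJ)_t$, and $\mathcal S_t(R)=F_t(R)/P(R)$ is the quotient by the group $P(R)$ of nonzero principal fractional ideals (so the classes of $I$ and $J$ coincide iff $I=cJ$ for some $0\neq c\in K$). A commutative semigroup $S$ is Clifford if for every $x\in S$ there is $a\in S$ with $x^2a=x$. $R$ is Clifford $t$-regular if $\mathcal S_t(R)$ is Clifford. $R$ is a PVMD if $R_M$ is a valuation domain for each $t$-maximal ideal $M$ of $R$. $R$ has finite $t$-character if each nonzero nonunit of $R$ is contained in only finitely many $t$-maximal ideals. A Krull-type domain is a PVMD with finite $t$-character. *)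

theory Defs
  imports
    "HOL-Computational_Algebra.Polynomial_Factorial"
    "HOL-Algebra.Coset"
begin

text \<open>
  The domain \<open>R\<close> is an arbitrary type \<open>'a :: idom\<close>, its quotient field \<open>K\<close> is the type \<open>'a fract\<close>,
  and all ideals (integral ideals included) are subsets of \<open>'a fract\<close>.
\<close>

definition base_ring :: "'a::idom fract set" where
  "base_ring = range to_fract"

definition fscale :: "'a::idom \<Rightarrow> 'a fract \<Rightarrow> 'a fract" where
  "fscale r x = to_fract r * x"

interpretation fmod: module "fscale :: 'a::idom \<Rightarrow> 'a fract \<Rightarrow> 'a fract"
  by unfold_locales (simp_all add: fscale_def algebra_simps)

definition fractional_ideal :: "'a::idom fract set \<Rightarrow> bool" where
  "fractional_ideal I \<longleftrightarrow>
     fmod.subspace I \<and> (\<exists>d::'a. d \<noteq> 0 \<and> (\<forall>x\<in>I. to_fract d * x \<in> base_ring))"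

definition fg_fractional_ideal :: "'a::idom fract set \<Rightarrow> bool" where
  "fg_fractional_ideal I \<longleftrightarrow> fractional_ideal I \<and> (\<exists>B. finite B \<and> I = fmod.span B)"

definition ideal_quot :: "'a::idom fract set \<Rightarrow> 'a fract set \<Rightarrow> 'a fract set" where
  "ideal_quot I J = {x. \<forall>y\<in>J. x * y \<in> I}"

definition ideal_inverse :: "'a::idom fract set \<Rightarrow> 'a fract set" where
  "ideal_inverse I = ideal_quot base_ring I"

definition v_closure :: "'a::idom fract set \<Rightarrow> 'a fract set" where
  "v_closure I = ideal_inverse (ideal_inverse I)"

definition t_closure :: "'a::idom fract set \<Rightarrow> 'a fract set" where
  "t_closure I = \<Union> {v_closure J | J. fg_fractional_ideal J \<and> J \<noteq> {0} \<and> J \<subseteq> I}"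

definition t_ideal :: "'a::idom fract set \<Rightarrow> bool" where
  "t_ideal I \<longleftrightarrow> fractional_ideal I \<and> I \<noteq> {0} \<and> t_closure I = I"

definition proper_integral_t_ideal :: "'a::idom fract set \<Rightarrow> bool" where
  "proper_integral_t_ideal I \<longleftrightarrow> t_ideal I \<and> I \<subset> base_ring"

definition t_maximal :: "'a::idom fract set \<Rightarrow> bool" where
  "t_maximal M \<longleftrightarrow>
     proper_integral_t_ideal M \<and> (\<forall>N. proper_integral_t_ideal N \<and> M \<subseteq> N \<longrightarrow> N = M)"

definition ideal_prod :: "'a::idom fract set \<Rightarrow> 'a fract set \<Rightarrow> 'a fract set" where
  "ideal_prod I J = fmod.span {x * y | x y. x \<in> I \<and> y \<in> J}"

definition t_ideal_semigroup :: "'a::idom fract set monoid" where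
  "t_ideal_semigroup =
     \<lparr>carrier = {I. t_ideal I}, mult = (\<lambda>I J. t_closure (ideal_prod I J)), one = base_ring\<rparr>"

definition principal_ideals :: "'a::idom fract set set" where
  "principal_ideals = {fmod.span {c} | c. c \<noteq> 0}"

text \<open>
  \<open>t_ideal_semigroup\<close> is only a monoid, not a group, but \<^const>\<open>FactGroup\<close> needs no group axioms to be
  defined and is the intended quotient here: the coset of a \<open>t\<close>-ideal \<open>I\<close> is \<open>{c I | c \<noteq> 0}\<close>, as
  \<open>(c R I)\<^sub>t = c I\<close> (see \<open>t_class_eq\<close> below), and the elementwise product of the cosets of \<open>I\<close> and \<open>J\<close>
  is the coset of \<open>(I J)\<^sub>t\<close>.
\<close>

definition t_class_semigroup :: "'a::idom fract set set monoid" where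
  "t_class_semigroup = t_ideal_semigroup Mod principal_ideals"

definition commutative_semigroup :: "('s, 'm) monoid_scheme \<Rightarrow> bool" where
  "commutative_semigroup S \<longleftrightarrow>
     (\<forall>x\<in>carrier S. \<forall>y\<in>carrier S. x \<otimes>\<^bsub>S\<^esub> y \<in> carrier S \<and> x \<otimes>\<^bsub>S\<^esub> y = y \<otimes>\<^bsub>S\<^esub> x) \<and>
     (\<forall>x\<in>carrier S. \<forall>y\<in>carrier S. \<forall>z\<in>carrier S.
        (x \<otimes>\<^bsub>S\<^esub> y) \<otimes>\<^bsub>S\<^esub> z = x \<otimes>\<^bsub>S\<^esub> (y \<otimes>\<^bsub>S\<^esub> z))"

definition clifford_semigroup :: "('s, 'm) monoid_scheme \<Rightarrow> bool" where
  "clifford_semigroup S \<longleftrightarrow> commutative_semigroup S \<and>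
     (\<forall>x\<in>carrier S. \<exists>a\<in>carrier S. (x \<otimes>\<^bsub>S\<^esub> x) \<otimes>\<^bsub>S\<^esub> a = x)"

definition clifford_t_regular :: "'a::idom itself \<Rightarrow> bool" where
  "clifford_t_regular _ \<longleftrightarrow> clifford_semigroup (t_class_semigroup :: 'a fract set set monoid)"

definition localization_at :: "'a::idom fract set \<Rightarrow> 'a fract set" where
  "localization_at M = {x / s | x s. x \<in> base_ring \<and> s \<in> base_ring - M}"

text \<open>A valuation domain with quotient field \<open>'k\<close>, given as a subring of \<open>'k\<close>.\<close>

definition valuation_domain :: "'k::field set \<Rightarrow> bool" where
  "valuation_domain V \<longleftrightarrow>
     1 \<in> V \<and> (\<forall>x\<in>V. \<forall>y\<in>V. x - y \<in> V \<and> x * y \<in> V) \<and>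
     (\<forall>x. x \<noteq> 0 \<longrightarrow> x \<in> V \<or> inverse x \<in> V)"

definition pvmd :: "'a::idom itself \<Rightarrow> bool" where
  "pvmd _ \<longleftrightarrow> (\<forall>M :: 'a fract set. t_maximal M \<longrightarrow> valuation_domain (localization_at M))"

definition finite_t_character :: "'a::idom itself \<Rightarrow> bool" where
  "finite_t_character _ \<longleftrightarrow>
     (\<forall>a::'a. a \<noteq> 0 \<and> \<not> (a dvd 1) \<longrightarrow> finite {M. t_maximal M \<and> to_fract a \<in> M})"

definition krull_type_domain :: "'a::idom itself \<Rightarrow> bool" where
  "krull_type_domain T \<longleftrightarrow> pvmd T \<and> finite_t_character T"

lemma subspace_image_mult:
  assumes "fmod.subspace I"
  shows "fmod.subspace ((*) c ` I)"
proof (rule fmod.subspaceI)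
  show "0 \<in> (*) c ` I"
    using fmod.subspace_0[OF assms] by force
next
  fix x y assume "x \<in> (*) c ` I" "y \<in> (*) c ` I"
  then obtain u v where "u \<in> I" "v \<in> I" "x = c * u" "y = c * v" by blast
  then show "x + y \<in> (*) c ` I"
    using fmod.subspace_add[OF assms] by (metis distrib_left imageI)
next
  fix r x assume "x \<in> (*) c ` I"
  then obtain u where u: "u \<in> I" "x = c * u" by blast
  then have "fscale r x = c * fscale r u" by (simp add: fscale_def)
  then show "fscale r x \<in> (*) c ` I"
    using fmod.subspace_scale[OF assms u(1)] by blast
qed

lemma image_mult_inverse:
  fixes c :: "'k::field"
  assumes "c \<noteq> 0"
  shows "(*) c ` (*) (inverse c) ` A = A" "(*) (inverse c) ` (*) c ` A = A"
  using assms by (simp_all add: image_image mult.assoc[symmetric])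

lemma span_image_mult:
  assumes "c \<noteq> 0"
  shows "fmod.span ((*) c ` B) = (*) c ` fmod.span B"
proof -
  have sub: "fmod.span ((*) e ` A) \<subseteq> (*) e ` fmod.span A" for e A
    by (rule fmod.span_minimal)
      (auto intro: subspace_image_mult fmod.span_base)
  have "(*) c ` fmod.span B = (*) c ` fmod.span ((*) (inverse c) ` (*) c ` B)"
    by (simp only: image_mult_inverse(2)[OF assms])
  also have "\<dots> \<subseteq> (*) c ` (*) (inverse c) ` fmod.span ((*) c ` B)"
    by (rule image_mono[OF sub])
  also have "\<dots> = fmod.span ((*) c ` B)"
    by (simp only: image_mult_inverse(1)[OF assms])
  finally show ?thesis using sub by blast
qed

lemma fractional_ideal_image_mult:
  fixes c :: "'a::idom fract"
  assumes "fractional_ideal I"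
  shows "fractional_ideal ((*) c ` I)"
proof -
  from assms obtain d :: 'a where d: "d \<noteq> 0" "\<forall>x\<in>I. to_fract d * x \<in> base_ring"
    and I: "fmod.subspace I" unfolding fractional_ideal_def by blast
  obtain p q :: 'a where pq: "c = Fract p q" "q \<noteq> 0"
    by (cases c) auto
  have qc: "to_fract q * c = to_fract p"
    using pq by (simp add: to_fract_def eq_fract)
  have "to_fract (d * q) * (c * x) \<in> base_ring" if "x \<in> I" for x
  proof -
    from d that obtain r where r: "to_fract d * x = to_fract r"
      by (auto simp: base_ring_def)
    have "to_fract (d * q) * (c * x) = (to_fract q * c) * (to_fract d * x)"
      by (simp add: mult_ac)
    also have "\<dots> = to_fract (p * r)" by (simp add: qc r)
    finally show ?thesis unfolding base_ring_def by (metis rangeI)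
  qed
  then show ?thesis
    using d(1) pq(2) subspace_image_mult[OF I] unfolding fractional_ideal_def
    by (intro conjI exI[of _ "d * q"]) auto
qed

lemma ideal_inverse_image_mult:
  assumes "c \<noteq> 0"
  shows "ideal_inverse ((*) c ` I) = (*) (inverse c) ` ideal_inverse I"
proof (intro Set.set_eqI iffI)
  fix x assume "x \<in> ideal_inverse ((*) c ` I)"
  then have "c * x \<in> ideal_inverse I"
    by (auto simp: ideal_inverse_def ideal_quot_def mult_ac)
  moreover have "x = inverse c * (c * x)" using assms by simp
  ultimately show "x \<in> (*) (inverse c) ` ideal_inverse I" by blast
next
  fix x assume "x \<in> (*) (inverse c) ` ideal_inverse I"
  then obtain y where y: "\<forall>z\<in>I. y * z \<in> base_ring" and x: "x = inverse c * y"
    by (auto simp: ideal_inverse_def ideal_quot_def)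
  have "x * c = y" using assms by (simp add: x field_simps)
  with y show "x \<in> ideal_inverse ((*) c ` I)"
    by (auto simp: ideal_inverse_def ideal_quot_def mult.assoc[symmetric])
qed

lemma v_closure_image_mult:
  assumes "c \<noteq> 0"
  shows "v_closure ((*) c ` I) = (*) c ` v_closure I"
  using assms by (simp add: v_closure_def ideal_inverse_image_mult)

lemma t_closure_image_mult:
  assumes "c \<noteq> 0"
  shows "t_closure ((*) c ` I) = (*) c ` t_closure I"
proof -
  have sub: "(*) e ` t_closure A \<subseteq> t_closure ((*) e ` A)" if e: "e \<noteq> 0" for e A
  proof
    fix x assume "x \<in> (*) e ` t_closure A"
    then obtain J where J: "fg_fractional_ideal J" "J \<noteq> {0}" "J \<subseteq> A" and x: "x \<in> (*) e ` v_closure J"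
      unfolding t_closure_def by blast
    have "fg_fractional_ideal ((*) e ` J)"
      using J(1) e unfolding fg_fractional_ideal_def
      by (metis finite_imageI fractional_ideal_image_mult span_image_mult)
    moreover have "(*) e ` J \<noteq> {0}"
    proof
      assume "(*) e ` J = {0}"
      then have "(*) (inverse e) ` (*) e ` J = {0}" by simp
      then show False using J(2) image_mult_inverse(2)[OF e] by metis
    qed
    moreover have "(*) e ` J \<subseteq> (*) e ` A" using J(3) by blast
    moreover have "x \<in> v_closure ((*) e ` J)"
      using x by (simp add: v_closure_image_mult[OF e])
    ultimately show "x \<in> t_closure ((*) e ` A)"
      unfolding t_closure_def by blast
  qed
  have "t_closure ((*) c ` I) = (*) c ` (*) (inverse c) ` t_closure ((*) c ` I)"
    by (simp only: image_mult_inverse(1)[OF assms])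
  also have "\<dots> \<subseteq> (*) c ` t_closure ((*) (inverse c) ` (*) c ` I)"
    using assms by (intro image_mono sub) simp
  also have "\<dots> = (*) c ` t_closure I"
    by (simp only: image_mult_inverse(2)[OF assms])
  finally show ?thesis using sub[OF assms] by blast
qed

lemma ideal_prod_principal:
  assumes "fmod.subspace I" "c \<noteq> 0"
  shows "ideal_prod (fmod.span {c}) I = (*) c ` I"
proof (rule antisym)
  show "ideal_prod (fmod.span {c}) I \<subseteq> (*) c ` I"
    unfolding ideal_prod_def
  proof (rule fmod.span_minimal[OF _ subspace_image_mult[OF assms(1)]], safe)
    fix x y assume "x \<in> fmod.span {c}" "y \<in> I"
    then obtain r where "x = fscale r c" by (auto simp: fmod.span_singleton)
    then have "x * y = c * fscale r y" by (simp add: fscale_def)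
    then show "x * y \<in> (*) c ` I"
      using fmod.subspace_scale[OF assms(1) \<open>y \<in> I\<close>] by blast
  qed
  show "(*) c ` I \<subseteq> ideal_prod (fmod.span {c}) I"
    unfolding ideal_prod_def by (auto intro!: fmod.span_base)
qed

lemma t_class_eq:
  assumes "t_ideal I"
  shows "principal_ideals #>\<^bsub>t_ideal_semigroup\<^esub> I = {(*) c ` I | c. c \<noteq> 0}"
proof -
  have "t_closure (ideal_prod (fmod.span {c}) I) = (*) c ` I" if "c \<noteq> 0" for c
    using assms that
    by (simp add: t_ideal_def fractional_ideal_def ideal_prod_principal t_closure_image_mult)
  then show ?thesis
    unfolding r_coset_def principal_ideals_def t_ideal_semigroup_def by auto
qed

end

theory Submission
  imports Defs
begin

text \<open>
  Clifford regularity of the class semigroup amounts to a statement about ideals: every t-ideal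
  \<open>I\<close> has a t-ideal \<open>A\<close> with \<open>(I I A)\<^sub>t = I\<close>, because a scalar \<open>c\<close> by which the two sides differ can be
  moved into \<open>A\<close> (\<open>clifford_t_regular_iff\<close>). In a PVMD such equations can be checked one t-maximal ideal
  \<open>M\<close> at a time: the t-closure of \<open>I\<close> is the intersection of the extensions \<open>I R\<^sub>M\<close>
  (\<open>t_closure_subset_extension_at\<close>, \<open>t_closure_local\<close>), and each \<open>R\<^sub>M\<close> is a valuation ring.

  Finite t-character implies Clifford regularity. For an integral t-ideal \<open>I\<close> the candidate is
  \<open>A = (I : I I)\<close>. Over a valuation ring every \<open>a \<in> I\<close> can be written as \<open>b c z\<close> with \<open>b, c \<in> I\<close> and
  \<open>z I I \<subseteq> I\<close> (\<open>pvmd_local_regular\<close>). Such a local multiplier \<open>z\<close> has to be turned into an element of \<open>A\<close>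
  by an \<open>s \<notin> M\<close>. At one other t-maximal ideal \<open>N\<close> a suitable \<open>s\<close> always exists (\<open>pvmd_transfer_colon\<close>),
  and at all \<open>N\<close> that do not contain \<open>b c\<close> the choice \<open>s = 1\<close> works. Finite t-character leaves finitely many
  conditions, which the product of the \<open>s\<close> satisfies together.

  Clifford regularity implies finite t-character. If \<open>I\<close> is a t-ideal with every \<open>I R\<^sub>M\<close> principal, then
  \<open>(I I A)\<^sub>t = I\<close> forces \<open>(I A)\<^sub>t = R\<close> (\<open>locally_principal_t_invertible\<close>), so that finitely many elements of \<open>I\<close>
  already generate it up to t-closure. Now suppose that \<open>x \<noteq> 0\<close> lies in infinitely many t-maximal ideals. Then there are
  finite sets \<open>B\<^sub>0, B\<^sub>1, \<dots>\<close> containing \<open>x\<close>, each inside some t-maximal ideal, no two of them inside a common one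
  (\<open>separated_sequence\<close>). The t-ideals \<open>D n\<close> generated by \<open>x\<close> and the \<open>(x : B\<^sub>k)\<close>, \<open>k < n\<close>, increase with \<open>n\<close>, and at
  each t-maximal ideal at most one step of the chain is strict. Hence their union is locally principal;
  but it is not t-invertible, since it grows at a t-maximal ideal containing \<open>B\<^sub>n\<close> after stage \<open>n\<close>, for
  every \<open>n\<close>.
\<close>

section \<open>The base ring and its submodules\<close>

lemma base_ring_0 [simp]: "0 \<in> base_ring"
  unfolding base_ring_def by (metis rangeI to_fract_0)

lemma base_ring_1 [simp]: "1 \<in> base_ring"
  unfolding base_ring_def by (metis rangeI to_fract_1)

lemma base_ring_add: "x \<in> base_ring \<Longrightarrow> y \<in> base_ring \<Longrightarrow> x + y \<in> base_ring"
  unfolding base_ring_def by (auto simp flip: to_fract_add)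

lemma base_ring_mult: "x \<in> base_ring \<Longrightarrow> y \<in> base_ring \<Longrightarrow> x * y \<in> base_ring"
  unfolding base_ring_def by (auto simp flip: to_fract_mult)

lemma base_ring_prod: "(\<And>i. i \<in> A \<Longrightarrow> f i \<in> base_ring) \<Longrightarrow> prod f A \<in> base_ring"
  by (induction A rule: infinite_finite_induct) (auto intro: base_ring_mult)

lemma fract_quotient:
  fixes c :: "'a::idom fract"
  obtains p q where "p \<in> base_ring" "q \<in> base_ring" "q \<noteq> 0" "q * c = p"
proof -
  obtain a b :: 'a where ab: "c = Fract a b" "b \<noteq> 0" by (cases c) auto
  have "to_fract b * c = to_fract a" using ab by (simp add: to_fract_def eq_fract)
  with ab(2) show ?thesis using that[of "to_fract a" "to_fract b"] by (auto simp: base_ring_def)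
qed

lemma subspace_mult: "fmod.subspace I \<Longrightarrow> r \<in> base_ring \<Longrightarrow> x \<in> I \<Longrightarrow> r * x \<in> I"
  using fmod.subspace_scale[of I x] by (auto simp: base_ring_def fscale_def)

lemma subspace_intro:
  assumes "0 \<in> I" "\<And>x y. x \<in> I \<Longrightarrow> y \<in> I \<Longrightarrow> x + y \<in> I"
    "\<And>r x. r \<in> base_ring \<Longrightarrow> x \<in> I \<Longrightarrow> r * x \<in> I"
  shows "fmod.subspace I"
  using assms by (intro fmod.subspaceI) (auto simp: fscale_def base_ring_def)

lemma subspace_base_ring: "fmod.subspace base_ring"
  by (rule subspace_intro) (auto intro: base_ring_add base_ring_mult)

text \<open>
The denominator may be any nonzero element of the quotient field: its numerator is a denominator as well.
\<close>

lemma fractional_idealI: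
  fixes c :: "'a::idom fract"
  assumes "fmod.subspace I" "c \<noteq> 0" "\<And>x. x \<in> I \<Longrightarrow> c * x \<in> base_ring"
  shows "fractional_ideal I"
proof -
  obtain p q where pq: "p \<in> base_ring" "q \<in> base_ring" "q \<noteq> 0" "q * c = p"
    by (rule fract_quotient)
  obtain d :: 'a where d: "p = to_fract d" using pq(1) by (auto simp: base_ring_def)
  have "d \<noteq> 0" using d pq assms(2) by auto
  moreover have "to_fract d * x \<in> base_ring" if "x \<in> I" for x
    using base_ring_mult[OF pq(2) assms(3)[OF that]] by (simp add: d[symmetric] pq(4)[symmetric] mult.assoc)
  ultimately show ?thesis using assms(1) unfolding fractional_ideal_def by blast
qed

lemma fractional_idealE:
  assumes "fractional_ideal I"
  obtains c where "c \<in> base_ring" "c \<noteq> 0" "\<And>x. x \<in> I \<Longrightarrow> c * x \<in> base_ring"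
proof -
  obtain d where d: "d \<noteq> 0" "\<forall>x\<in>I. to_fract d * x \<in> base_ring"
    using assms unfolding fractional_ideal_def by blast
  show ?thesis by (rule that[of "to_fract d"]) (use d in \<open>auto simp: base_ring_def\<close>)
qed

lemma fractional_ideal_subspace: "fractional_ideal I \<Longrightarrow> fmod.subspace I"
  by (simp add: fractional_ideal_def)

lemma subspace_nonzero:
  assumes "fmod.subspace I" "I \<noteq> {0}"
  obtains i where "i \<in> I" "i \<noteq> 0"
  using assms fmod.subspace_0[OF assms(1)] by blast

section \<open>The divisorial closure and the t-closure\<close>

lemma ideal_inverse_iff: "x \<in> ideal_inverse B \<longleftrightarrow> (\<forall>y\<in>B. x * y \<in> base_ring)"
  by (simp add: ideal_inverse_def ideal_quot_def)

lemma ideal_inverse_antimono: "B \<subseteq> C \<Longrightarrow> ideal_inverse C \<subseteq> ideal_inverse B"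
  by (fastforce simp: ideal_inverse_iff)

lemma subspace_ideal_inverse: "fmod.subspace (ideal_inverse B)"
  by (rule subspace_intro)
    (auto simp: ideal_inverse_iff distrib_right mult.assoc intro: base_ring_add base_ring_mult)

lemma ideal_inverse_span: "ideal_inverse (fmod.span B) = ideal_inverse B"
proof
  show "ideal_inverse (fmod.span B) \<subseteq> ideal_inverse B"
    by (intro ideal_inverse_antimono fmod.span_superset)
  show "ideal_inverse B \<subseteq> ideal_inverse (fmod.span B)"
  proof
    fix x assume "x \<in> ideal_inverse B"
    then have "B \<subseteq> {y. y * x \<in> base_ring}" by (auto simp: ideal_inverse_iff mult.commute)
    moreover have "fmod.subspace {y. y * x \<in> base_ring}"
      by (rule subspace_intro)
        (auto simp: distrib_right mult.assoc intro: base_ring_add base_ring_mult)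
    ultimately have "fmod.span B \<subseteq> {y. y * x \<in> base_ring}" by (rule fmod.span_minimal)
    then show "x \<in> ideal_inverse (fmod.span B)" by (auto simp: ideal_inverse_iff mult.commute)
  qed
qed

lemma v_closure_extensive: "B \<subseteq> v_closure B"
  by (fastforce simp: v_closure_def ideal_inverse_iff mult.commute)

lemma v_closure_mono: "B \<subseteq> C \<Longrightarrow> v_closure B \<subseteq> v_closure C"
  by (simp add: v_closure_def ideal_inverse_antimono)

lemma v_closure_least: 
  assumes "B \<subseteq> v_closure C" shows "v_closure B \<subseteq> v_closure C"
proof -
  have "ideal_inverse C \<subseteq> ideal_inverse (v_closure C)"
    unfolding v_closure_def using v_closure_extensive[of "ideal_inverse C"]
    by (simp add: v_closure_def)
  also have "\<dots> \<subseteq> ideal_inverse B" by (rule ideal_inverse_antimono[OF assms])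
  finally show ?thesis unfolding v_closure_def by (rule ideal_inverse_antimono)
qed

lemma v_closure_span: "v_closure (fmod.span B) = v_closure B"
  by (simp add: v_closure_def ideal_inverse_span)

lemma subspace_v_closure: "fmod.subspace (v_closure B)"
  by (simp add: v_closure_def subspace_ideal_inverse)

text \<open>
The form in which divisorial closures are used below: a common denominator of \<open>B\<close> is one of \<open>B\<^sub>v\<close>.
\<close>

lemma v_closure_bound:
  assumes "x \<in> v_closure B" "\<And>b. b \<in> B \<Longrightarrow> c * b \<in> base_ring"
  shows "c * x \<in> base_ring"
proof -
  have "c \<in> ideal_inverse B" using assms(2) by (simp add: ideal_inverse_iff)
  with assms(1) have "x * c \<in> base_ring" by (simp add: v_closure_def ideal_inverse_iff)
  then show ?thesis by (simp add: mult.commute)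
qed

text \<open>
Replaces the finitely generated ideals in the definition by finite sets, which generate the same
divisorial ideals. The exclusion of the zero ideal matters over a field, where the divisorial closure of \<open>{0}\<close> is
everything.
\<close>

lemma t_closure_iff:
  assumes "fractional_ideal I"
  shows "x \<in> t_closure I \<longleftrightarrow> (\<exists>B. finite B \<and> B \<subseteq> I \<and> \<not> B \<subseteq> {0} \<and> x \<in> v_closure B)"
proof
  assume "x \<in> t_closure I"
  then obtain J where J: "fg_fractional_ideal J" "J \<noteq> {0}" "J \<subseteq> I" "x \<in> v_closure J"
    unfolding t_closure_def by blast
  then obtain B where B: "finite B" "J = fmod.span B" unfolding fg_fractional_ideal_def by blast
  have "\<not> B \<subseteq> {0}"
  proof
    assume "B \<subseteq> {0}"
    then have "J \<subseteq> {0}" unfolding B(2)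
      by (intro fmod.span_minimal) (auto intro: fmod.subspace_single_0)
    with J(2) show False using B(2) fmod.span_zero by blast
  qed
  moreover have "B \<subseteq> I" using B J(3) fmod.span_superset by blast
  moreover have "x \<in> v_closure B" using J(4) by (simp add: B(2) v_closure_span)
  ultimately show "\<exists>B. finite B \<and> B \<subseteq> I \<and> \<not> B \<subseteq> {0} \<and> x \<in> v_closure B" using B(1) by blast
next
  assume "\<exists>B. finite B \<and> B \<subseteq> I \<and> \<not> B \<subseteq> {0} \<and> x \<in> v_closure B"
  then obtain B where B: "finite B" "B \<subseteq> I" "\<not> B \<subseteq> {0}" "x \<in> v_closure B" by blast
  have sub: "fmod.span B \<subseteq> I"
    using B(2) fractional_ideal_subspace[OF assms] by (rule fmod.span_minimal)
  have "fractional_ideal (fmod.span B)"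
    using assms sub unfolding fractional_ideal_def by (meson fmod.subspace_span subset_iff)
  moreover have "fmod.span B \<noteq> {0}" using B(3) fmod.span_superset[of B] by auto
  moreover have "x \<in> v_closure (fmod.span B)" using B(4) by (simp add: v_closure_span)
  ultimately show "x \<in> t_closure I"
    unfolding t_closure_def fg_fractional_ideal_def using B(1) sub by blast
qed

lemma t_closure_mono: "I \<subseteq> J \<Longrightarrow> t_closure I \<subseteq> t_closure J"
  unfolding t_closure_def by blast

lemma t_closure_extensive:
  assumes "fractional_ideal I" "I \<noteq> {0}"
  shows "I \<subseteq> t_closure I"
proof
  fix x assume x: "x \<in> I"
  obtain i where i: "i \<in> I" "i \<noteq> 0"
    using subspace_nonzero[OF fractional_ideal_subspace[OF assms(1)] assms(2)] .
  have "x \<in> v_closure {x, i}" using v_closure_extensive by blast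
  then show "x \<in> t_closure I" using x i by (auto simp: t_closure_iff[OF assms(1)] intro!: exI[of _ "{x, i}"])
qed

lemma finite_subset_t_closure:
  assumes "fractional_ideal I" "finite B" "B \<subseteq> t_closure I" "I \<noteq> {0}"
  shows "\<exists>C. finite C \<and> C \<subseteq> I \<and> \<not> C \<subseteq> {0} \<and> B \<subseteq> v_closure C"
  using assms(2,3)
proof (induction B rule: finite_induct)
  case empty
  obtain i where i: "i \<in> I" "i \<noteq> 0"
    using subspace_nonzero[OF fractional_ideal_subspace[OF assms(1)] assms(4)] .
  then show ?case by (intro exI[of _ "{i}"]) auto
next
  case (insert b B)
  then obtain C where C: "finite C" "C \<subseteq> I" "\<not> C \<subseteq> {0}" "B \<subseteq> v_closure C" by auto
  obtain D where D: "finite D" "D \<subseteq> I" "b \<in> v_closure D"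
    using insert.prems by (auto simp: t_closure_iff[OF assms(1)])
  have "v_closure C \<subseteq> v_closure (C \<union> D)" "v_closure D \<subseteq> v_closure (C \<union> D)"
    by (auto intro!: v_closure_mono)
  then show ?case using C D by (intro exI[of _ "C \<union> D"]) auto
qed

text \<open>
Closing \<open>I\<close> under divisorial closures of finite subsets is a condition of finite character, so it passes to
colon ideals and to unions of chains.
\<close>

lemma t_ideal_iff:
  "t_ideal I \<longleftrightarrow> fractional_ideal I \<and> I \<noteq> {0} \<and>
     (\<forall>B. finite B \<longrightarrow> B \<subseteq> I \<longrightarrow> \<not> B \<subseteq> {0} \<longrightarrow> v_closure B \<subseteq> I)"
proof -
  have "t_closure I = I \<longleftrightarrow> (\<forall>B. finite B \<longrightarrow> B \<subseteq> I \<longrightarrow> \<not> B \<subseteq> {0} \<longrightarrow> v_closure B \<subseteq> I)"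
    if I: "fractional_ideal I" "I \<noteq> {0}"
  proof -
    have "t_closure I = I \<longleftrightarrow> t_closure I \<subseteq> I" using t_closure_extensive[OF I] by blast
    also have "\<dots> \<longleftrightarrow> (\<forall>B. finite B \<longrightarrow> B \<subseteq> I \<longrightarrow> \<not> B \<subseteq> {0} \<longrightarrow> v_closure B \<subseteq> I)"
      unfolding subset_iff[of "t_closure I"] t_closure_iff[OF I(1)] by blast
    finally show ?thesis .
  qed
  then show ?thesis unfolding t_ideal_def by blast
qed

lemma t_idealD:
  assumes "t_ideal I"
  shows "fmod.subspace I" "fractional_ideal I" "I \<noteq> {0}" "t_closure I = I"
  using assms by (auto simp: t_ideal_def fractional_ideal_def)

lemma t_ideal_t_closure:
  assumes I: "fractional_ideal I" "I \<noteq> {0}"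
  shows "t_ideal (t_closure I)"
  unfolding t_ideal_iff
proof (intro conjI allI impI)
  have absorb: "v_closure B \<subseteq> t_closure I" if B: "finite B" "B \<subseteq> t_closure I" for B
  proof -
    obtain C where C: "finite C" "C \<subseteq> I" "\<not> C \<subseteq> {0}" "B \<subseteq> v_closure C"
      using finite_subset_t_closure[OF I(1) B I(2)] by blast
    have "v_closure B \<subseteq> v_closure C" by (rule v_closure_least[OF C(4)])
    also have "\<dots> \<subseteq> t_closure I" using C t_closure_iff[OF I(1)] by blast
    finally show ?thesis .
  qed
  then show "v_closure B \<subseteq> t_closure I" if "finite B" "B \<subseteq> t_closure I" for B using that by blast
  have "x + y \<in> t_closure I" if "x \<in> t_closure I" "y \<in> t_closure I" for x y
    using absorb[of "{x, y}"] that v_closure_extensive[of "{x, y}"]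
      fmod.subspace_add[OF subspace_v_closure[of "{x, y}"], of x y] by auto
  moreover have "r * x \<in> t_closure I" if "r \<in> base_ring" "x \<in> t_closure I" for r x
    using absorb[of "{x}"] that v_closure_extensive[of "{x}"]
      subspace_mult[OF subspace_v_closure[of "{x}"] that(1), of x] by auto
  moreover have sup: "I \<subseteq> t_closure I" by (rule t_closure_extensive[OF I])
  then have "0 \<in> t_closure I" using fmod.subspace_0[OF fractional_ideal_subspace[OF I(1)]] by blast
  ultimately have sub: "fmod.subspace (t_closure I)" by (blast intro: subspace_intro)
  obtain c where c: "c \<noteq> 0" "\<And>x. x \<in> I \<Longrightarrow> c * x \<in> base_ring"
    using fractional_idealE[OF I(1)] by blast
  show "fractional_ideal (t_closure I)"
  proof (rule fractional_idealI[OF sub c(1)])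
    fix x assume "x \<in> t_closure I"
    then obtain B where B: "B \<subseteq> I" "x \<in> v_closure B" using t_closure_iff[OF I(1)] by blast
    show "c * x \<in> base_ring"
      by (rule v_closure_bound[OF B(2)]) (use B(1) c(2) in blast)
  qed
  show "t_closure I \<noteq> {0}"
    using sup I(2) fmod.subspace_0[OF fractional_ideal_subspace[OF I(1)]] by blast
qed

lemma t_ideal_base_ring: "t_ideal (base_ring :: 'a::idom fract set)"
proof -
  have "v_closure B \<subseteq> base_ring" if "B \<subseteq> base_ring" for B :: "'a fract set"
    using v_closure_bound[of _ B 1] that by auto
  moreover have "fractional_ideal (base_ring :: 'a fract set)"
    by (rule fractional_idealI[OF subspace_base_ring, of 1]) auto
  moreover have "(base_ring :: 'a fract set) \<noteq> {0}"
    using base_ring_1 zero_neq_one by (metis singletonD)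
  ultimately show ?thesis unfolding t_ideal_iff by blast
qed

lemma t_ideal_image_mult:
  assumes "t_ideal I" "c \<noteq> 0"
  shows "t_ideal ((*) c ` I)"
proof -
  obtain i where "i \<in> I" "i \<noteq> 0"
    using subspace_nonzero[OF t_idealD(1,3)[OF assms(1)]] .
  then have "c * i \<in> (*) c ` I" "c * i \<noteq> 0" using assms(2) by auto
  then have "(*) c ` I \<noteq> {0}" by (metis singletonD)
  then show ?thesis unfolding t_ideal_def
    using t_idealD[OF assms(1)] fractional_ideal_image_mult t_closure_image_mult[OF assms(2)] by metis
qed

text \<open>
The divisorial closure commutes with multiplication by \<open>a\<close>; hence colon ideals of t-ideals inherit the
closure condition.
\<close>

lemma v_closure_multiples:
  assumes "t_ideal I" "finite B" "\<not> B \<subseteq> {0}" "x \<in> v_closure B" "\<And>b. b \<in> B \<Longrightarrow> b * a \<in> I"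
  shows "x * a \<in> I"
proof (cases "a = 0")
  case True
  then show ?thesis using fmod.subspace_0[OF t_idealD(1)[OF assms(1)]] by simp
next
  case False
  have "a * x \<in> v_closure ((*) a ` B)"
    using assms(4) by (auto simp: v_closure_image_mult[OF False])
  moreover have "v_closure ((*) a ` B) \<subseteq> I"
  proof -
    have "finite ((*) a ` B)" "(*) a ` B \<subseteq> I" "\<not> (*) a ` B \<subseteq> {0}"
      using assms(2,3,5) False by (auto simp: mult.commute)
    then show ?thesis using assms(1) unfolding t_ideal_iff by blast
  qed
  ultimately show ?thesis by (metis mult.commute subsetD)
qed

lemma t_ideal_colon:
  assumes I: "t_ideal I"
  shows "t_ideal {r \<in> base_ring. r * a \<in> I}" (is "t_ideal ?C")
  unfolding t_ideal_iff
proof (intro conjI allI impI)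
  note subI = t_idealD(1)[OF I]
  have sub: "fmod.subspace ?C"
    using subI by (intro subspace_intro)
      (auto simp: distrib_right mult.assoc fmod.subspace_0 fmod.subspace_add subspace_mult
        base_ring_add base_ring_mult)
  show "fractional_ideal ?C" by (rule fractional_idealI[OF sub, of 1]) auto
  show "?C \<noteq> {0}"
  proof (cases "a = 0")
    case True
    then have "1 \<in> ?C" using fmod.subspace_0[OF subI] by simp
    then show ?thesis by (metis singletonD zero_neq_one)
  next
    case False
    obtain i where i: "i \<in> I" "i \<noteq> 0" using subspace_nonzero[OF subI t_idealD(3)[OF I]] .
    obtain p q where pq: "p \<in> base_ring" "q \<in> base_ring" "q \<noteq> 0" "q * (i / a) = p"
      by (rule fract_quotient)
    have "p * a = q * i" using pq(4) False by auto
    then have "p \<in> ?C" "p \<noteq> 0" using pq i False subspace_mult[OF subI pq(2) i(1)] by auto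
    then show ?thesis by blast
  qed
  fix B assume B: "finite B" "B \<subseteq> ?C" "\<not> B \<subseteq> {0}"
  show "v_closure B \<subseteq> ?C"
  proof
    fix x assume x: "x \<in> v_closure B"
    have "x * 1 \<in> base_ring"
      by (rule v_closure_multiples[OF t_ideal_base_ring B(1,3) x]) (use B(2) in auto)
    moreover have "x * a \<in> I"
      by (rule v_closure_multiples[OF I B(1,3) x]) (use B(2) in auto)
    ultimately show "x \<in> ?C" by simp
  qed
qed

section \<open>t-maximal ideals\<close>

lemma proper_integral_t_ideal_iff:
  "proper_integral_t_ideal I \<longleftrightarrow> t_ideal I \<and> I \<subseteq> base_ring \<and> 1 \<notin> I"
proof
  assume "proper_integral_t_ideal I"
  then have I: "t_ideal I" "I \<subset> base_ring" by (auto simp: proper_integral_t_ideal_def)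
  then obtain r where r: "r \<in> base_ring" "r \<notin> I" by blast
  then have "1 \<notin> I" using subspace_mult[OF t_idealD(1)[OF I(1)] r(1), of 1] by auto
  with I show "t_ideal I \<and> I \<subseteq> base_ring \<and> 1 \<notin> I" by blast
next
  assume "t_ideal I \<and> I \<subseteq> base_ring \<and> 1 \<notin> I"
  then show "proper_integral_t_ideal I"
    using base_ring_1 unfolding proper_integral_t_ideal_def by blast
qed

text \<open>
Zorn's lemma applies because a finite subset of the union of a chain lies in one member, so that the union is
again a t-ideal.
\<close>

lemma subset_t_maximal:
  assumes "proper_integral_t_ideal I"
  obtains M where "t_maximal M" "I \<subseteq> M"
proof -
  let ?A = "{J. proper_integral_t_ideal J \<and> I \<subseteq> J}"
  have "\<exists>M\<in>?A. \<forall>X\<in>?A. M \<subseteq> X \<longrightarrow> X = M"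
  proof (rule subset_Zorn_nonempty)
    show "?A \<noteq> {}" using assms by blast
    fix C assume C: "C \<noteq> {}" "subset.chain ?A C"
    then have CA: "J \<in> C \<Longrightarrow> proper_integral_t_ideal J \<and> I \<subseteq> J" for J
      by (auto simp: subset.chain_def)
    note CA' = CA[THEN conjunct1, unfolded proper_integral_t_ideal_iff]
    have fin: "\<exists>J\<in>C. B \<subseteq> J" if "finite B" "B \<subseteq> \<Union>C" for B
      using finite_subset_Union_chain[OF that C] by blast
    have sub: "fmod.subspace (\<Union>C)"
    proof (rule subspace_intro)
      show "0 \<in> \<Union>C" using C(1) CA' t_idealD(1) fmod.subspace_0 by (metis UnionI ex_in_conv)
      show "r * x \<in> \<Union>C" if "r \<in> base_ring" "x \<in> \<Union>C" for r x
        using that CA' t_idealD(1) subspace_mult by (metis UnionE UnionI)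
      fix x y assume "x \<in> \<Union>C" "y \<in> \<Union>C"
      then obtain J where "J \<in> C" "{x, y} \<subseteq> J" using fin[of "{x, y}"] by blast
      then show "x + y \<in> \<Union>C" using CA' t_idealD(1) fmod.subspace_add by (metis UnionI insert_subset)
    qed
    have "t_ideal (\<Union>C)"
      unfolding t_ideal_iff
    proof (intro conjI allI impI)
      show "fractional_ideal (\<Union>C)"
        by (rule fractional_idealI[OF sub, of 1]) (use CA' in auto)
      obtain J where J: "J \<in> C" using C(1) by blast
      obtain i where "i \<in> J" "i \<noteq> 0"
        using subspace_nonzero[of J] t_idealD[of J] CA'[OF J] by blast
      then show "\<Union>C \<noteq> {0}" using J by blast
      fix B assume B: "finite B" "B \<subseteq> \<Union>C" "\<not> B \<subseteq> {0}"
      then obtain J where "J \<in> C" "B \<subseteq> J" using fin by blast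
      then show "v_closure B \<subseteq> \<Union>C" using CA'[of J] B t_ideal_iff[of J] by blast
    qed
    then have "proper_integral_t_ideal (\<Union>C)"
      unfolding proper_integral_t_ideal_iff using CA' by blast
    moreover have "I \<subseteq> \<Union>C" using C(1) CA by blast
    ultimately show "\<Union>C \<in> ?A" by blast
  qed
  then obtain M where M: "proper_integral_t_ideal M" "I \<subseteq> M"
    and max: "\<forall>X\<in>?A. M \<subseteq> X \<longrightarrow> X = M" by auto
  then have "t_maximal M" unfolding t_maximal_def by auto
  with M(2) show ?thesis using that by blast
qed

lemma t_maximalD:
  assumes "t_maximal M"
  shows "t_ideal M" "M \<subseteq> base_ring" "1 \<notin> M" "0 \<in> M" "fmod.subspace M"
    "\<And>N. t_ideal N \<Longrightarrow> N \<subseteq> base_ring \<Longrightarrow> 1 \<notin> N \<Longrightarrow> M \<subseteq> N \<Longrightarrow> N = M"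
  using assms t_idealD(1)[of M] fmod.subspace_0[of M]
  unfolding t_maximal_def proper_integral_t_ideal_iff by auto

text \<open>
The colon ideal \<open>(M : b)\<close> is a t-ideal containing \<open>M\<close>, and it is proper because \<open>b \<notin> M\<close>.
\<close>

lemma t_maximal_prime:
  assumes M: "t_maximal M" and "a \<in> base_ring" "b \<in> base_ring" "a * b \<in> M" "b \<notin> M"
  shows "a \<in> M"
proof -
  note MD = t_maximalD[OF M]
  have "{r \<in> base_ring. r * b \<in> M} = M"
  proof (rule MD(6))
    show "t_ideal {r \<in> base_ring. r * b \<in> M}" by (rule t_ideal_colon[OF MD(1)])
    show "M \<subseteq> {r \<in> base_ring. r * b \<in> M}"
      using MD(2) subspace_mult[OF MD(5) assms(3)] by (auto simp: mult.commute)
  qed (use assms(5) in auto)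
  then show ?thesis using assms by blast
qed

lemma t_maximal_complement_mult:
  assumes "t_maximal M" "s \<in> base_ring - M" "t \<in> base_ring - M"
  shows "s * t \<in> base_ring - M"
  using assms t_maximal_prime[OF assms(1), of s t] base_ring_mult by blast

lemma t_maximal_complement_prod:
  assumes "t_maximal M" "finite A" "\<And>i. i \<in> A \<Longrightarrow> f i \<in> base_ring - M"
  shows "prod f A \<in> base_ring - M"
  using assms(2,3)
proof (induction A rule: finite_induct)
  case empty
  then show ?case using t_maximalD(3)[OF assms(1)] by simp
next
  case (insert i A)
  then show ?case using t_maximal_complement_mult[OF assms(1)] by simp
qed

text \<open>
The t-closure of \<open>M1 + M2\<close> contains both ideals properly, so it contains \<open>1\<close>, and this is already
witnessed by finitely many sums. Only their summands are kept.
\<close>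

lemma t_maximal_comaximal:
  assumes M1: "t_maximal M1" and M2: "t_maximal M2" and ne: "M1 \<noteq> M2"
  shows "\<exists>H1 H2. finite H1 \<and> finite H2 \<and> H1 \<subseteq> M1 \<and> H2 \<subseteq> M2 \<and> (\<forall>M. t_maximal M \<longrightarrow> \<not> H1 \<union> H2 \<subseteq> M)"
proof -
  note D1 = t_maximalD[OF M1] and D2 = t_maximalD[OF M2]
  define S where "S = {x + y | x y. x \<in> M1 \<and> y \<in> M2}"
  have "S = fmod.span (M1 \<union> M2)"
    using D1(5) D2(5) by (simp add: S_def fmod.span_Un fmod.span_eq_iff[THEN iffD2])
  then have subS: "fmod.subspace S" by simp
  have SR: "S \<subseteq> base_ring" using D1(2) D2(2) by (auto simp: S_def intro: base_ring_add)
  have MS: "M1 \<subseteq> S" "M2 \<subseteq> S"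
    unfolding \<open>S = fmod.span (M1 \<union> M2)\<close> using fmod.span_superset by blast+
  have frac: "fractional_ideal S" by (rule fractional_idealI[OF subS, of 1]) (use SR in auto)
  have nz: "S \<noteq> {0}" using MS(1) t_idealD(3)[OF D1(1)] D1(4) by auto
  have "1 \<in> t_closure S"
  proof (rule ccontr)
    assume 1: "1 \<notin> t_closure S"
    have t: "t_ideal (t_closure S)" by (rule t_ideal_t_closure[OF frac nz])
    have "t_closure S \<subseteq> base_ring"
      using t_closure_mono[OF SR] t_idealD(4)[OF t_ideal_base_ring] by blast
    note max = t this 1
    have ext: "S \<subseteq> t_closure S" by (rule t_closure_extensive[OF frac nz])
    have "t_closure S = M1" by (rule D1(6)[OF max]) (use MS(1) ext in blast)
    moreover have "t_closure S = M2" by (rule D2(6)[OF max]) (use MS(2) ext in blast)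
    ultimately show False using ne by simp
  qed
  then have "\<exists>B. finite B \<and> B \<subseteq> S \<and> \<not> B \<subseteq> {0} \<and> 1 \<in> v_closure B"
    by (simp only: t_closure_iff[OF frac])
  then obtain B where B: "finite B" "B \<subseteq> S" "\<not> B \<subseteq> {0}" "1 \<in> v_closure B" by blast
  have "\<forall>b\<in>B. \<exists>x y. x \<in> M1 \<and> y \<in> M2 \<and> b = x + y" using B(2) unfolding S_def by blast
  then obtain f g where fg: "\<And>b. b \<in> B \<Longrightarrow> f b \<in> M1 \<and> g b \<in> M2 \<and> b = f b + g b" by metis
  have "\<not> f ` B \<union> g ` B \<subseteq> M" if M: "t_maximal M" for M
  proof
    assume sub: "f ` B \<union> g ` B \<subseteq> M"
    have "B \<subseteq> M"
    proof
      fix b assume "b \<in> B"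
      then have "f b \<in> M" "g b \<in> M" using sub by auto
      then have "f b + g b \<in> M" by (rule fmod.subspace_add[OF t_maximalD(5)[OF M]])
      then show "b \<in> M" using fg[OF \<open>b \<in> B\<close>] by simp
    qed
    then have "v_closure B \<subseteq> M" using B(1,3) t_maximalD(1)[OF M] unfolding t_ideal_iff by blast
    with B(4) have "1 \<in> M" by blast
    then show False using t_maximalD(3)[OF M] by blast
  qed
  moreover have "f ` B \<subseteq> M1" "g ` B \<subseteq> M2" using fg by auto
  ultimately show ?thesis using B(1) by (intro exI[of _ "f ` B"] exI[of _ "g ` B"]) auto
qed

section \<open>Products of fractional ideals\<close>

lemma subspace_ideal_prod: "fmod.subspace (ideal_prod I J)"
  by (simp add: ideal_prod_def)

lemma ideal_prodI: "x \<in> I \<Longrightarrow> y \<in> J \<Longrightarrow> x * y \<in> ideal_prod I J"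
  unfolding ideal_prod_def by (rule fmod.span_base) blast

lemma ideal_prod_subset_iff:
  assumes "fmod.subspace W"
  shows "ideal_prod I J \<subseteq> W \<longleftrightarrow> (\<forall>x\<in>I. \<forall>y\<in>J. x * y \<in> W)"
proof
  show "\<forall>x\<in>I. \<forall>y\<in>J. x * y \<in> W" if "ideal_prod I J \<subseteq> W" using that ideal_prodI by blast
  show "ideal_prod I J \<subseteq> W" if "\<forall>x\<in>I. \<forall>y\<in>J. x * y \<in> W"
    unfolding ideal_prod_def using that assms by (intro fmod.span_minimal) auto
qed

lemma ideal_prod_mono: "I \<subseteq> I' \<Longrightarrow> J \<subseteq> J' \<Longrightarrow> ideal_prod I J \<subseteq> ideal_prod I' J'"
  unfolding ideal_prod_subset_iff[OF subspace_ideal_prod] by (blast intro: ideal_prodI)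

lemma ideal_prod_commute: "ideal_prod I J = ideal_prod J I"
proof -
  have "ideal_prod I J \<subseteq> ideal_prod J I" for I J :: "'a::idom fract set"
    unfolding ideal_prod_subset_iff[OF subspace_ideal_prod] using ideal_prodI
    by (metis mult.commute)
  then show ?thesis by blast
qed

text \<open>
Containment of a triple product in a submodule can be tested on products of elements, although the elements of
the inner product are sums.
\<close>

lemma ideal_prod_induct2:
  assumes "fmod.subspace W" "\<And>x y z. x \<in> I \<Longrightarrow> y \<in> J \<Longrightarrow> z \<in> L \<Longrightarrow> x * y * z \<in> W"
  shows "ideal_prod (ideal_prod I J) L \<subseteq> W"
  unfolding ideal_prod_subset_iff[OF assms(1)]
proof (intro ballI)
  fix p z assume p: "p \<in> ideal_prod I J" and z: "z \<in> L"
  have "fmod.subspace {q. q * z \<in> W}"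
    using assms(1) by (intro subspace_intro)
      (auto simp: distrib_right mult.assoc fmod.subspace_0 fmod.subspace_add subspace_mult)
  then have "ideal_prod I J \<subseteq> {q. q * z \<in> W}"
    using assms(2) z by (auto simp: ideal_prod_subset_iff)
  with p show "p * z \<in> W" by blast
qed

lemma ideal_prod_assoc: "ideal_prod (ideal_prod I J) L = ideal_prod I (ideal_prod J L)"
proof -
  have sub: "ideal_prod (ideal_prod I J) L \<subseteq> ideal_prod I (ideal_prod J L)"
    for I J L :: "'a::idom fract set"
  proof (rule ideal_prod_induct2[OF subspace_ideal_prod])
    fix x y z assume "x \<in> I" "y \<in> J" "z \<in> L"
    then have "x * (y * z) \<in> ideal_prod I (ideal_prod J L)" by (intro ideal_prodI)
    then show "x * y * z \<in> ideal_prod I (ideal_prod J L)" by (simp add: mult.assoc)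
  qed
  have "ideal_prod I (ideal_prod J L) = ideal_prod (ideal_prod L J) I"
    by (simp only: ideal_prod_commute[of I] ideal_prod_commute[of J])
  also have "\<dots> \<subseteq> ideal_prod L (ideal_prod J I)" by (rule sub)
  also have "\<dots> = ideal_prod (ideal_prod I J) L"
    by (simp only: ideal_prod_commute[of L] ideal_prod_commute[of J])
  finally show ?thesis using sub by blast
qed

lemma ideal_prod_image_mult:
  assumes "c \<noteq> 0"
  shows "ideal_prod ((*) c ` I) J = (*) c ` ideal_prod I J"
proof -
  have "{x * y |x y. x \<in> (*) c ` I \<and> y \<in> J} = (*) c ` {x * y |x y. x \<in> I \<and> y \<in> J}"
  proof (intro Set.set_eqI iffI)
    fix z assume "z \<in> {x * y |x y. x \<in> (*) c ` I \<and> y \<in> J}"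
    then obtain x y where "x \<in> I" "y \<in> J" "z = c * (x * y)" by (auto simp: mult.assoc)
    then show "z \<in> (*) c ` {x * y |x y. x \<in> I \<and> y \<in> J}" by blast
  next
    fix z assume "z \<in> (*) c ` {x * y |x y. x \<in> I \<and> y \<in> J}"
    then obtain x y where "x \<in> I" "y \<in> J" "z = (c * x) * y" by (auto simp: mult.assoc)
    then show "z \<in> {x * y |x y. x \<in> (*) c ` I \<and> y \<in> J}" by blast
  qed
  then show ?thesis by (simp add: ideal_prod_def span_image_mult[OF assms])
qed

lemma fractional_ideal_prod:
  assumes "fractional_ideal I" "fractional_ideal J"
  shows "fractional_ideal (ideal_prod I J)"
proof -
  obtain c where c: "c \<noteq> 0" "\<And>x. x \<in> I \<Longrightarrow> c * x \<in> base_ring" using fractional_idealE[OF assms(1)] by blast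
  obtain d where d: "d \<noteq> 0" "\<And>x. x \<in> J \<Longrightarrow> d * x \<in> base_ring" using fractional_idealE[OF assms(2)] by blast
  have "fmod.subspace {z. (c * d) * z \<in> base_ring}"
    by (intro subspace_intro)
      (auto simp: distrib_left mult.left_commute[of "c * d"] base_ring_add base_ring_mult)
  moreover have "c * d * (x * y) \<in> base_ring" if "x \<in> I" "y \<in> J" for x y
    using base_ring_mult[OF c(2)[OF that(1)] d(2)[OF that(2)]] by (simp add: mult_ac)
  ultimately have "ideal_prod I J \<subseteq> {z. (c * d) * z \<in> base_ring}"
    by (simp add: ideal_prod_subset_iff)
  then show ?thesis
    using c(1) d(1) by (intro fractional_idealI[OF subspace_ideal_prod, of "c * d"]) auto
qed

lemma ideal_prod_nonzero:
  assumes "fmod.subspace I" "I \<noteq> {0}" "fmod.subspace J" "J \<noteq> {0}"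
  shows "ideal_prod I J \<noteq> {0}"
proof -
  obtain i where "i \<in> I" "i \<noteq> 0" using subspace_nonzero[OF assms(1,2)] .
  moreover obtain j where "j \<in> J" "j \<noteq> 0" using subspace_nonzero[OF assms(3,4)] .
  ultimately have "i * j \<in> ideal_prod I J" "i * j \<noteq> 0" by (auto intro: ideal_prodI)
  then show ?thesis by blast
qed

text \<open>
Multiplication by an element of \<open>J\<close> carries the divisorial closure of a finite subset of \<open>I\<close> to that of a finite subset
of the product. This makes the t-product associative.
\<close>

lemma t_closure_prod_t_closure:
  assumes I: "fractional_ideal I" "I \<noteq> {0}" and J: "fractional_ideal J" "J \<noteq> {0}"
  shows "t_closure (ideal_prod (t_closure I) J) = t_closure (ideal_prod I J)"
proof
  note sub = fractional_ideal_subspace[OF I(1)] fractional_ideal_subspace[OF J(1)]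
  have IJ: "fractional_ideal (ideal_prod I J)" "ideal_prod I J \<noteq> {0}"
    using fractional_ideal_prod[OF I(1) J(1)] ideal_prod_nonzero[OF sub(1) I(2) sub(2) J(2)] by auto
  note tIJ = t_ideal_t_closure[OF IJ]
  have "x * y \<in> t_closure (ideal_prod I J)" if x: "x \<in> t_closure I" and y: "y \<in> J" for x y
  proof -
    obtain B where B: "finite B" "B \<subseteq> I" "\<not> B \<subseteq> {0}" "x \<in> v_closure B"
      using x unfolding t_closure_iff[OF I(1)] by blast
    show ?thesis
    proof (rule v_closure_multiples[OF tIJ B(1,3,4)])
      fix b assume "b \<in> B"
      then have "b * y \<in> ideal_prod I J" using B(2) y by (auto intro: ideal_prodI)
      then show "b * y \<in> t_closure (ideal_prod I J)" using t_closure_extensive[OF IJ] by blast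
    qed
  qed
  then have "ideal_prod (t_closure I) J \<subseteq> t_closure (ideal_prod I J)"
    using t_idealD(1)[OF tIJ] by (simp add: ideal_prod_subset_iff)
  then have "t_closure (ideal_prod (t_closure I) J) \<subseteq> t_closure (t_closure (ideal_prod I J))"
    by (rule t_closure_mono)
  then show "t_closure (ideal_prod (t_closure I) J) \<subseteq> t_closure (ideal_prod I J)"
    by (simp only: t_idealD(4)[OF tIJ])
  show "t_closure (ideal_prod I J) \<subseteq> t_closure (ideal_prod (t_closure I) J)"
    by (intro t_closure_mono ideal_prod_mono t_closure_extensive[OF I] subset_refl)
qed

lemma t_ideal_prod:
  assumes "t_ideal I" "t_ideal J"
  shows "fractional_ideal (ideal_prod I J)" "ideal_prod I J \<noteq> {0}"
  using fractional_ideal_prod[OF t_idealD(2)[OF assms(1)] t_idealD(2)[OF assms(2)]]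
    ideal_prod_nonzero[OF t_idealD(1,3)[OF assms(1)] t_idealD(1,3)[OF assms(2)]]
  by blast+

lemma t_ideal_t_product:
  assumes "t_ideal I" "t_ideal J"
  shows "t_ideal (t_closure (ideal_prod I J))"
  by (rule t_ideal_t_closure[OF t_ideal_prod[OF assms]])

lemma t_product_assoc:
  fixes I J L :: "'a::idom fract set"
  assumes "t_ideal I" "t_ideal J" "t_ideal L"
  shows "t_closure (ideal_prod (t_closure (ideal_prod I J)) L) = t_closure (ideal_prod (ideal_prod I J) L)"
    "t_closure (ideal_prod I (t_closure (ideal_prod J L))) = t_closure (ideal_prod (ideal_prod I J) L)"
proof -
  show "t_closure (ideal_prod (t_closure (ideal_prod I J)) L) = t_closure (ideal_prod (ideal_prod I J) L)"
    by (rule t_closure_prod_t_closure[OF t_ideal_prod[OF assms(1,2)] t_idealD(2,3)[OF assms(3)]])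
  have "ideal_prod I (t_closure (ideal_prod J L)) = ideal_prod (t_closure (ideal_prod J L)) I"
    by (rule ideal_prod_commute)
  moreover have "t_closure (ideal_prod (t_closure (ideal_prod J L)) I) = t_closure (ideal_prod (ideal_prod J L) I)"
    by (rule t_closure_prod_t_closure[OF t_ideal_prod[OF assms(2,3)] t_idealD(2,3)[OF assms(1)]])
  moreover have "ideal_prod (ideal_prod J L) I = ideal_prod (ideal_prod I J) L"
    using ideal_prod_commute[of "ideal_prod J L" I] ideal_prod_assoc[of I J L] by simp
  ultimately show "t_closure (ideal_prod I (t_closure (ideal_prod J L))) = t_closure (ideal_prod (ideal_prod I J) L)"
    by simp
qed

section \<open>The t-class semigroup\<close>

abbreviation t_class :: "'a::idom fract set \<Rightarrow> 'a fract set set" where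
  "t_class I \<equiv> principal_ideals #>\<^bsub>t_ideal_semigroup\<^esub> I"

lemma t_class_eqD:
  assumes "t_ideal I" "t_ideal J" "t_class I = t_class J"
  obtains c where "c \<noteq> 0" "I = (*) c ` J"
proof -
  have "I = (*) 1 ` I" by simp
  then have "I \<in> t_class I" unfolding t_class_eq[OF assms(1)] by (metis (mono_tags, lifting) mem_Collect_eq zero_neq_one)
  then show ?thesis using that unfolding assms(3) t_class_eq[OF assms(2)] by blast
qed

text \<open>
Multiplying representatives by \<open>c\<close> and \<open>d\<close> multiplies the t-product by \<open>c d\<close>; conversely every scalar \<open>c\<close> is \<open>c 1\<close>.
\<close>

lemma t_class_mult:
  fixes I J :: "'a::idom fract set"
  assumes "t_ideal I" "t_ideal J"
  shows "t_class I \<otimes>\<^bsub>t_class_semigroup\<^esub> t_class J = t_class (t_closure (ideal_prod I J))"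
proof -
  have eq: "t_closure (ideal_prod ((*) c ` I) ((*) d ` J)) = (*) (c * d) ` t_closure (ideal_prod I J)"
    if "c \<noteq> 0" "d \<noteq> 0" for c d
  proof -
    have "ideal_prod ((*) c ` I) ((*) d ` J) = (*) c ` (*) d ` ideal_prod I J"
      by (simp only: ideal_prod_image_mult[OF that(1)] ideal_prod_image_mult[OF that(2)]
          ideal_prod_commute[of I])
    then have "t_closure (ideal_prod ((*) c ` I) ((*) d ` J)) = (*) c ` (*) d ` t_closure (ideal_prod I J)"
      by (simp only: t_closure_image_mult[OF that(1)] t_closure_image_mult[OF that(2)])
    then show ?thesis by (simp add: image_image mult.assoc)
  qed
  have "t_class I \<otimes>\<^bsub>t_class_semigroup\<^esub> t_class J =
      (\<Union>X\<in>t_class I. \<Union>Y\<in>t_class J. {t_closure (ideal_prod X Y)})"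
    by (simp add: t_class_semigroup_def FactGroup_def set_mult_def t_ideal_semigroup_def)
  also have "\<dots> = {(*) c ` t_closure (ideal_prod I J) | c. c \<noteq> 0}"
  proof (intro Set.set_eqI iffI)
    fix Z assume "Z \<in> (\<Union>X\<in>t_class I. \<Union>Y\<in>t_class J. {t_closure (ideal_prod X Y)})"
    then obtain c d where cd: "c \<noteq> 0" "d \<noteq> 0" "Z = t_closure (ideal_prod ((*) c ` I) ((*) d ` J))"
      unfolding t_class_eq[OF assms(1)] t_class_eq[OF assms(2)] by auto
    then have "Z = (*) (c * d) ` t_closure (ideal_prod I J)" "c * d \<noteq> 0" by (simp_all add: eq)
    then show "Z \<in> {(*) c ` t_closure (ideal_prod I J) | c. c \<noteq> 0}" by blast
  next
    fix Z assume "Z \<in> {(*) c ` t_closure (ideal_prod I J) | c. c \<noteq> 0}"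
    then obtain c where c: "c \<noteq> 0" "Z = (*) c ` t_closure (ideal_prod I J)" by blast
    then have "Z = t_closure (ideal_prod ((*) c ` I) ((*) 1 ` J))" using eq[of c 1] by simp
    moreover have "(*) c ` I \<in> t_class I" using c(1) by (auto simp: t_class_eq[OF assms(1)])
    moreover have "(*) 1 ` J \<in> t_class J"
      unfolding t_class_eq[OF assms(2)] by (rule CollectI, rule exI[of _ 1]) simp
    ultimately show "Z \<in> (\<Union>X\<in>t_class I. \<Union>Y\<in>t_class J. {t_closure (ideal_prod X Y)})" by blast
  qed
  finally show ?thesis by (simp only: t_class_eq[OF t_ideal_t_product[OF assms]])
qed

lemma carrier_t_class_semigroup: "carrier t_class_semigroup = {t_class I | I. t_ideal I}"
  by (auto simp: t_class_semigroup_def FactGroup_def RCOSETS_def t_ideal_semigroup_def)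

lemma commutative_t_class_semigroup:
  "commutative_semigroup (t_class_semigroup :: 'a::idom fract set set monoid)"
  unfolding commutative_semigroup_def
proof (intro conjI ballI)
  fix x y :: "'a fract set set"
  assume "x \<in> carrier t_class_semigroup" "y \<in> carrier t_class_semigroup"
  then obtain I J where IJ: "t_ideal I" "x = t_class I" "t_ideal J" "y = t_class J"
    by (auto simp: carrier_t_class_semigroup)
  have eq: "x \<otimes>\<^bsub>t_class_semigroup\<^esub> y = t_class (t_closure (ideal_prod I J))"
    using IJ by (simp add: t_class_mult)
  then show "x \<otimes>\<^bsub>t_class_semigroup\<^esub> y \<in> carrier t_class_semigroup"
    using t_ideal_t_product[OF IJ(1,3)] by (auto simp: carrier_t_class_semigroup)
  show "x \<otimes>\<^bsub>t_class_semigroup\<^esub> y = y \<otimes>\<^bsub>t_class_semigroup\<^esub> x"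
    using IJ by (simp add: eq t_class_mult ideal_prod_commute[of I])
next
  fix x y z :: "'a fract set set"
  assume "x \<in> carrier t_class_semigroup" "y \<in> carrier t_class_semigroup" "z \<in> carrier t_class_semigroup"
  then obtain I J L where IJL: "t_ideal I" "x = t_class I" "t_ideal J" "y = t_class J" "t_ideal L" "z = t_class L"
    by (auto simp: carrier_t_class_semigroup)
  then show "(x \<otimes>\<^bsub>t_class_semigroup\<^esub> y) \<otimes>\<^bsub>t_class_semigroup\<^esub> z
      = x \<otimes>\<^bsub>t_class_semigroup\<^esub> (y \<otimes>\<^bsub>t_class_semigroup\<^esub> z)"
    by (simp add: t_class_mult t_ideal_t_product t_product_assoc)
qed

text \<open>
If \<open>I\<close> and \<open>(I I A)\<^sub>t\<close> lie in the same class, say \<open>I = c (I I A)\<^sub>t\<close>, then replacing \<open>A\<close> by \<open>c A\<close> gives an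
equality of ideals.
\<close>

lemma clifford_t_regular_iff:
  "clifford_t_regular TYPE('a::idom) \<longleftrightarrow>
    (\<forall>I :: 'a fract set. t_ideal I \<longrightarrow>
      (\<exists>A. t_ideal A \<and> t_closure (ideal_prod (ideal_prod I I) A) = I))"
proof -
  have "(\<exists>A. t_ideal A \<and> (t_class I \<otimes>\<^bsub>t_class_semigroup\<^esub> t_class I) \<otimes>\<^bsub>t_class_semigroup\<^esub> t_class A = t_class I)
    \<longleftrightarrow> (\<exists>A. t_ideal A \<and> t_closure (ideal_prod (ideal_prod I I) A) = I)"
    if I: "t_ideal I" for I :: "'a fract set"
  proof -
    have prod: "(t_class I \<otimes>\<^bsub>t_class_semigroup\<^esub> t_class I) \<otimes>\<^bsub>t_class_semigroup\<^esub> t_class A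
        = t_class (t_closure (ideal_prod (ideal_prod I I) A))" if "t_ideal A" for A
      using I that by (simp add: t_class_mult t_ideal_t_product t_product_assoc)
    show ?thesis
    proof
      assume "\<exists>A. t_ideal A \<and> t_closure (ideal_prod (ideal_prod I I) A) = I"
      then show "\<exists>A. t_ideal A \<and> (t_class I \<otimes>\<^bsub>t_class_semigroup\<^esub> t_class I) \<otimes>\<^bsub>t_class_semigroup\<^esub> t_class A = t_class I"
        using prod by metis
    next
      assume "\<exists>A. t_ideal A \<and> (t_class I \<otimes>\<^bsub>t_class_semigroup\<^esub> t_class I) \<otimes>\<^bsub>t_class_semigroup\<^esub> t_class A = t_class I"
      then obtain A where A: "t_ideal A" "t_class I = t_class (t_closure (ideal_prod (ideal_prod I I) A))"
        using prod by metis
      have "t_ideal (t_closure (ideal_prod (ideal_prod I I) A))"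
        using t_ideal_t_product[OF t_ideal_t_product[OF I I] A(1)] t_product_assoc(1)[OF I I A(1)] by simp
      then obtain c where c: "c \<noteq> 0" "I = (*) c ` t_closure (ideal_prod (ideal_prod I I) A)"
        using t_class_eqD[OF I _ A(2)] by blast
      have "t_closure (ideal_prod (ideal_prod I I) ((*) c ` A)) =
          (*) c ` t_closure (ideal_prod (ideal_prod I I) A)"
        by (simp only: ideal_prod_commute[of "ideal_prod I I"] ideal_prod_image_mult[OF c(1)]
            t_closure_image_mult[OF c(1)])
      then have "t_closure (ideal_prod (ideal_prod I I) ((*) c ` A)) = I" using c(2) by simp
      then show "\<exists>A. t_ideal A \<and> t_closure (ideal_prod (ideal_prod I I) A) = I"
        using t_ideal_image_mult[OF A(1) c(1)] by blast
    qed
  qed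
  note eq = this
  have "clifford_t_regular TYPE('a) \<longleftrightarrow> (\<forall>I :: 'a fract set. t_ideal I \<longrightarrow>
      (\<exists>A. t_ideal A \<and> (t_class I \<otimes>\<^bsub>t_class_semigroup\<^esub> t_class I) \<otimes>\<^bsub>t_class_semigroup\<^esub> t_class A = t_class I))"
    unfolding clifford_t_regular_def clifford_semigroup_def carrier_t_class_semigroup
    using commutative_t_class_semigroup by blast
  then show ?thesis using eq by simp
qed

section \<open>Localization at t-maximal ideals\<close>

text \<open>
The extension \<open>I R\<^sub>M\<close>. A finite sum of fractions with denominators outside the prime ideal \<open>M\<close> has a common
denominator, so no sums are needed.
\<close>

definition extension_at :: "'a::idom fract set \<Rightarrow> 'a fract set \<Rightarrow> 'a fract set" where
  "extension_at M I = {x. \<exists>s\<in>base_ring - M. s * x \<in> I}"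

lemma extension_atI: "s \<in> base_ring - M \<Longrightarrow> s * x \<in> I \<Longrightarrow> x \<in> extension_at M I"
  by (auto simp: extension_at_def)

lemma localization_at_eq:
  assumes "0 \<in> M"
  shows "localization_at M = extension_at M base_ring"
proof (intro Set.set_eqI iffI)
  fix x assume "x \<in> localization_at M"
  then obtain a s where "a \<in> base_ring" "s \<in> base_ring - M" "x = a / s"
    by (auto simp: localization_at_def)
  moreover from this assms have "s * x = a" by auto
  ultimately show "x \<in> extension_at M base_ring" using extension_atI by metis
next
  fix x assume "x \<in> extension_at M base_ring"
  then obtain s where s: "s \<in> base_ring - M" "s * x \<in> base_ring" by (auto simp: extension_at_def)
  then have "x = (s * x) / s" using assms by auto
  with s show "x \<in> localization_at M" unfolding localization_at_def by blast
qed

lemma extension_at_superset: "t_maximal M \<Longrightarrow> I \<subseteq> extension_at M I"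
  using t_maximalD(3)[of M] by (auto simp: extension_at_def intro!: bexI[of _ 1])

lemma extension_at_mult:
  assumes M: "t_maximal M" and "x \<in> extension_at M I" "y \<in> extension_at M J"
    and "\<And>a b. a \<in> I \<Longrightarrow> b \<in> J \<Longrightarrow> a * b \<in> L"
  shows "x * y \<in> extension_at M L"
proof -
  obtain s where s: "s \<in> base_ring - M" "s * x \<in> I" using assms(2) by (auto simp: extension_at_def)
  obtain t where t: "t \<in> base_ring - M" "t * y \<in> J" using assms(3) by (auto simp: extension_at_def)
  have "(s * t) * (x * y) \<in> L" using assms(4)[OF s(2) t(2)] by (simp add: mult_ac)
  then show ?thesis
    using t_maximal_complement_mult[OF M s(1) t(1)] unfolding extension_at_def by blast
qed

lemma extension_at_scale:
  assumes "t_maximal M" "fmod.subspace I" "x \<in> extension_at M base_ring" "y \<in> extension_at M I"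
  shows "x * y \<in> extension_at M I"
  by (rule extension_at_mult[OF assms(1,3,4)]) (rule subspace_mult[OF assms(2)])

lemma extension_at_cancel:
  assumes M: "t_maximal M" and "s \<in> base_ring - M" "s * x \<in> extension_at M I"
  shows "x \<in> extension_at M I"
proof -
  obtain t where t: "t \<in> base_ring - M" "t * (s * x) \<in> I" using assms(3) by (auto simp: extension_at_def)
  then have "t * s * x \<in> I" by (simp add: mult.assoc)
  then show ?thesis
    using t_maximal_complement_mult[OF M t(1) assms(2)] unfolding extension_at_def by blast
qed

lemma subspace_extension_at:
  assumes M: "t_maximal M" and I: "fmod.subspace I"
  shows "fmod.subspace (extension_at M I)"
proof (rule subspace_intro)
  show "0 \<in> extension_at M I" using extension_at_superset[OF M] fmod.subspace_0[OF I] by blast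
next
  fix x y assume "x \<in> extension_at M I" "y \<in> extension_at M I"
  then obtain s t where st: "s \<in> base_ring - M" "s * x \<in> I" "t \<in> base_ring - M" "t * y \<in> I"
    by (auto simp: extension_at_def)
  have "t * (s * x) + s * (t * y) \<in> I"
    by (rule fmod.subspace_add[OF I]; rule subspace_mult[OF I]) (use st in auto)
  then have "(s * t) * (x + y) \<in> I" by (simp add: algebra_simps)
  then show "x + y \<in> extension_at M I"
    using t_maximal_complement_mult[OF M st(1,3)] unfolding extension_at_def by blast
next
  fix r x :: "'a fract" assume "r \<in> base_ring" "x \<in> extension_at M I"
  then show "r * x \<in> extension_at M I"
    using extension_at_superset[OF M, of base_ring] extension_at_scale[OF M I] by blast
qed

lemma pvmd_valuation:
  assumes "pvmd TYPE('a::idom)" "t_maximal (M :: 'a fract set)"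
  shows "x \<in> extension_at M base_ring \<or> inverse x \<in> extension_at M base_ring"
proof (cases "x = 0")
  case True
  then show ?thesis using extension_at_superset[OF assms(2), of base_ring] by auto
next
  case False
  then show ?thesis
    using assms localization_at_eq[OF t_maximalD(4)[OF assms(2)]]
    unfolding pvmd_def valuation_domain_def by metis
qed

text \<open>
Submodules of a valuation ring are comparable: if \<open>y\<close> is outside \<open>I R\<^sub>M\<close>, then \<open>I R\<^sub>M\<close> is contained in \<open>y R\<^sub>M\<close>.
\<close>

lemma pvmd_quotient:
  assumes pv: "pvmd TYPE('a::idom)" and M: "t_maximal (M :: 'a fract set)" and I: "fmod.subspace I"
    and y: "y \<notin> extension_at M I" and i: "i \<in> extension_at M I"
  shows "i / y \<in> extension_at M base_ring"
proof (cases "i = 0")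
  case True
  then show ?thesis using extension_at_superset[OF M, of base_ring] by auto
next
  case False
  show ?thesis
  proof (rule ccontr)
    assume "i / y \<notin> extension_at M base_ring"
    then have "y / i \<in> extension_at M base_ring"
      using pvmd_valuation[OF pv M, of "i / y"] by simp
    then have "y / i * i \<in> extension_at M I" using i by (rule extension_at_scale[OF M I])
    with y False show False by simp
  qed
qed

text \<open>
A finitely generated ideal of a valuation ring is generated by the generator of least value. The common
denominator \<open>s\<close> makes the statement one about \<open>R\<close>.
\<close>

lemma pvmd_local_generator:
  assumes pv: "pvmd TYPE('a::idom)" and M: "t_maximal (M :: 'a fract set)"
    and "finite B" "\<not> B \<subseteq> {0}"
  shows "\<exists>f\<in>B. f \<noteq> 0 \<and> (\<exists>s\<in>base_ring - M. \<forall>b\<in>B. s * (b / f) \<in> base_ring)"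
  using assms(3,4)
proof (induction B rule: finite_induct)
  case (insert b B)
  have one: "1 \<in> base_ring - M" using t_maximalD(3)[OF M] by simp
  show ?case
  proof (cases "B \<subseteq> {0}")
    case True
    then have "\<forall>c\<in>insert b B. 1 * (c / b) \<in> base_ring" by auto
    then show ?thesis using True insert.prems one by blast
  next
    case False
    then obtain f s where f: "f \<in> B" "f \<noteq> 0" "s \<in> base_ring - M" "\<And>c. c \<in> B \<Longrightarrow> s * (c / f) \<in> base_ring"
      using insert.IH by blast
    consider t where "t \<in> base_ring - M" "t * (b / f) \<in> base_ring"
      | t where "b \<noteq> 0" "t \<in> base_ring - M" "t * (f / b) \<in> base_ring"
      using pvmd_valuation[OF pv M, of "b / f"] f(2) one unfolding extension_at_def by fastforce
    then show ?thesis
    proof cases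
      case 1
      have "s * t * (c / f) \<in> base_ring" if "c \<in> insert b B" for c
      proof (cases "c = b")
        case True
        then show ?thesis using base_ring_mult[of s "t * (b / f)"] f(3) 1(2) by (simp add: mult_ac)
      next
        case False
        then show ?thesis using base_ring_mult[of t "s * (c / f)"] f(4) 1(1) that by (simp add: mult_ac)
      qed
      then show ?thesis using f(1,2) t_maximal_complement_mult[OF M f(3) 1(1)] by blast
    next
      case 2
      have "s * t * (c / b) \<in> base_ring" if "c \<in> insert b B" for c
      proof (cases "c = b")
        case True
        then show ?thesis using base_ring_mult[of s t] f(3) 2 by simp
      next
        case False
        then have "c \<in> B" using that by simp
        then have "(s * (c / f)) * (t * (f / b)) \<in> base_ring"
          by (rule base_ring_mult[OF f(4) 2(3)])
        then show ?thesis using f(2) by (simp add: field_simps)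
      qed
      then show ?thesis using 2(1) t_maximal_complement_mult[OF M f(3) 2(2)] by blast
    qed
  qed
qed simp

text \<open>
For a finite set \<open>B\<close> with local generator \<open>f\<close>, the element \<open>s / f\<close> multiplies \<open>B\<close> and therefore also \<open>B\<^sub>v\<close> into \<open>R\<close>,
which puts \<open>B\<^sub>v\<close> into \<open>f R\<^sub>M\<close>.
\<close>

lemma t_closure_subset_extension_at:
  assumes pv: "pvmd TYPE('a::idom)" and M: "t_maximal (M :: 'a fract set)"
    and I: "fractional_ideal I"
  shows "t_closure I \<subseteq> extension_at M I"
proof
  fix x assume "x \<in> t_closure I"
  then obtain B where B: "finite B" "B \<subseteq> I" "\<not> B \<subseteq> {0}" "x \<in> v_closure B"
    unfolding t_closure_iff[OF I] by blast
  obtain f s where f: "f \<in> B" "f \<noteq> 0" "s \<in> base_ring - M" "\<And>b. b \<in> B \<Longrightarrow> s * (b / f) \<in> base_ring"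
    using pvmd_local_generator[OF pv M B(1,3)] by blast
  have "s / f * x \<in> base_ring" by (rule v_closure_bound[OF B(4)]) (use f(4) in simp)
  then have "s / f * x * f \<in> I"
    using f(1) B(2) by (intro subspace_mult[OF fractional_ideal_subspace[OF I]]) auto
  then have "s * x \<in> I" using f(2) by simp
  then show "x \<in> extension_at M I" using f(3) by (auto simp: extension_at_def)
qed

text \<open>
The conductor of \<open>x\<close> into \<open>I\<^sub>t\<close> is a t-ideal that meets the complement of every t-maximal ideal, so it cannot be
proper.
\<close>

lemma t_closure_local:
  assumes I: "fractional_ideal I" "I \<noteq> {0}" and x: "\<And>M. t_maximal M \<Longrightarrow> x \<in> extension_at M I"
  shows "x \<in> t_closure I"
proof (rule ccontr)
  assume nx: "x \<notin> t_closure I"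
  let ?C = "{r \<in> base_ring. r * x \<in> t_closure I}"
  have "t_ideal ?C" by (intro t_ideal_colon t_ideal_t_closure I)
  then have "proper_integral_t_ideal ?C" using nx unfolding proper_integral_t_ideal_iff by auto
  then obtain M where M: "t_maximal M" "?C \<subseteq> M" by (rule subset_t_maximal)
  obtain s where "s \<in> base_ring - M" "s * x \<in> I"
    using x[OF M(1)] by (auto simp: extension_at_def)
  then show False using M(2) t_closure_extensive[OF I] by blast
qed

lemma t_ideal_local:
  assumes "t_ideal I" "\<And>M. t_maximal M \<Longrightarrow> x \<in> extension_at M I"
  shows "x \<in> I"
  using t_closure_local[OF t_idealD(2,3)[OF assms(1)] assms(2)] t_idealD(4)[OF assms(1)] by simp

section \<open>Finite t-character implies Clifford t-regularity\<close>

text \<open>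
Clifford regularity of a valuation ring. If \<open>I I \<subseteq> a I\<close> locally, then \<open>b = c = a\<close> works. Otherwise some \<open>b c\<close> lies outside
\<open>a I\<close>; then \<open>a I \<subseteq> b c R\<^sub>M\<close> by comparability, so \<open>a / (b c)\<close> multiplies \<open>I\<close> into \<open>R\<^sub>M\<close>.
\<close>

lemma pvmd_local_regular:
  assumes pv: "pvmd TYPE('a::idom)" and M: "t_maximal (M :: 'a fract set)" and I: "fmod.subspace I"
    and a: "a \<in> I" "a \<noteq> 0"
  shows "\<exists>b\<in>I. \<exists>c\<in>I. b \<noteq> 0 \<and> c \<noteq> 0 \<and> (\<forall>i\<in>I. \<forall>j\<in>I. a / (b * c) * (i * j) \<in> extension_at M I)"
proof (cases "\<forall>b\<in>I. \<forall>c\<in>I. b * c / a \<in> extension_at M I")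
  case True
  then show ?thesis using a by (intro bexI[of _ a] conjI) auto
next
  case False
  then obtain b c where bc: "b \<in> I" "c \<in> I" "b * c / a \<notin> extension_at M I" by blast
  have "b \<noteq> 0" "c \<noteq> 0"
    using bc(3) extension_at_superset[OF M, of I] fmod.subspace_0[OF I] by auto
  moreover have "a / (b * c) * (i * j) \<in> extension_at M I" if "i \<in> I" "j \<in> I" for i j
  proof -
    have ij: "i \<in> extension_at M I" "j \<in> extension_at M I"
      using that extension_at_superset[OF M, of I] by auto
    have "i / (b * c / a) * j \<in> extension_at M I"
      by (intro extension_at_scale[OF M I] pvmd_quotient[OF pv M I bc(3)] ij)
    moreover have "i / (b * c / a) * j = a / (b * c) * (i * j)" by (simp add: field_simps)
    ultimately show ?thesis by (simp only:)
  qed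
  ultimately show ?thesis using bc(1,2) by blast
qed

text \<open>
A multiplier \<open>z\<close> of \<open>I I\<close> into \<open>I\<close> at \<open>M\<close> is one at \<open>N\<close> up to an element \<open>s\<close> outside \<open>M\<close>. The dichotomy is whether \<open>I R\<^sub>N\<close> is
stable under division by elements outside \<open>M\<close>. If it is, the denominators that occur at \<open>M\<close> are harmless at \<open>N\<close>. If
it is not, some \<open>h \<in> I\<close> has \<open>h / s\<close> outside \<open>I R\<^sub>N\<close>; then \<open>I R\<^sub>N\<close> lies between \<open>h R\<^sub>N\<close> and \<open>(h / s) R\<^sub>N\<close>, so that
it suffices to control the single product \<open>z h h\<close>.
\<close>

lemma pvmd_transfer_colon:
  assumes pv: "pvmd TYPE('a::idom)" and M: "t_maximal (M :: 'a fract set)" and N: "t_maximal N"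
    and I: "fmod.subspace I" and z: "\<And>i j. i \<in> I \<Longrightarrow> j \<in> I \<Longrightarrow> z * (i * j) \<in> extension_at M I"
  shows "\<exists>s\<in>base_ring - M. \<forall>i\<in>I. \<forall>j\<in>I. s * z * (i * j) \<in> extension_at N I"
proof (cases "\<forall>s\<in>base_ring - M. \<forall>i\<in>I. i / s \<in> extension_at N I")
  case True
  have "1 * z * (i * j) \<in> extension_at N I" if ij: "i \<in> I" "j \<in> I" for i j
  proof -
    obtain s where s: "s \<in> base_ring - M" "s * (z * (i * j)) \<in> I"
      using z[OF ij] by (auto simp: extension_at_def)
    then have "s * (z * (i * j)) / s \<in> extension_at N I" using True by blast
    moreover have "s \<noteq> 0" using s(1) t_maximalD(4)[OF M] by auto
    ultimately show ?thesis by simp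
  qed
  then show ?thesis using t_maximalD(3)[OF M] by (intro bexI[of _ 1]) auto
next
  case False
  then obtain s h where s: "s \<in> base_ring - M" "h \<in> I" "h / s \<notin> extension_at N I" by blast
  have s0: "s \<noteq> 0" using s(1) t_maximalD(4)[OF M] by auto
  have h0: "h \<noteq> 0" using s(3) extension_at_superset[OF N, of I] fmod.subspace_0[OF I] by auto
  obtain t where t: "t \<in> base_ring - M" "t * (z * (h * h)) \<in> I"
    using z[OF s(2,2)] by (auto simp: extension_at_def)
  have "t * s * s * z * (i * j) \<in> extension_at N I" if "i \<in> I" "j \<in> I" for i j
  proof -
    have sup: "I \<subseteq> extension_at N I" by (rule extension_at_superset[OF N])
    have "i / (h / s) \<in> extension_at N base_ring" "j / (h / s) \<in> extension_at N base_ring"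
      using that sup by (blast intro: pvmd_quotient[OF pv N I s(3)])+
    moreover have "t * (z * (h * h)) \<in> extension_at N I" using t(2) sup by blast
    ultimately have "i / (h / s) * (j / (h / s) * (t * (z * (h * h)))) \<in> extension_at N I"
      by (blast intro: extension_at_scale[OF N I])
    moreover have "i / (h / s) * (j / (h / s) * (t * (z * (h * h)))) = t * s * s * z * (i * j)"
      using h0 s0 by (simp add: field_simps)
    ultimately show ?thesis by simp
  qed
  then show ?thesis
    using t_maximal_complement_mult[OF M t_maximal_complement_mult[OF M t(1) s(1)] s(1)] by blast
qed

text \<open>
Units lie in no t-maximal ideal, which extends the finiteness from nonunits to all nonzero \<open>x\<close>.
\<close>

lemma finite_t_characterD:
  assumes fin: "finite_t_character TYPE('a::idom)" and x: "(x :: 'a fract) \<in> base_ring" "x \<noteq> 0"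
  shows "finite {M. t_maximal M \<and> x \<in> M}"
proof -
  obtain a where a: "x = to_fract a" using x(1) by (auto simp: base_ring_def)
  show ?thesis
  proof (cases "a dvd 1")
    case True
    then obtain b where "1 = a * b" by (auto simp: dvd_def)
    then have "x * to_fract b = 1" by (metis a to_fract_1 to_fract_mult)
    then have "x \<notin> M" if "t_maximal M" for M
      using subspace_mult[OF t_maximalD(5)[OF that], of "to_fract b" x] t_maximalD(3)[OF that]
      by (auto simp: base_ring_def mult.commute)
    then have "{M. t_maximal M \<and> x \<in> M} = {}" by blast
    then show ?thesis by (simp only: finite.emptyI)
  next
    case False
    moreover have "a \<noteq> 0" using x(2) a by auto
    ultimately show ?thesis using fin unfolding finite_t_character_def a by blast
  qed
qed

text \<open>
The local factorisation \<open>a = b c w\<close> becomes global after multiplication by an \<open>s\<close> outside \<open>M\<close>. Outside the finite set \<open>F\<close> of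
t-maximal ideals containing \<open>b c\<close>, the denominator of \<open>w\<close> is invertible and there is nothing to correct.
\<close>

lemma pvmd_finite_character_colon:
  assumes pv: "pvmd TYPE('a::idom)" and fin: "finite_t_character TYPE('a)"
    and I: "t_ideal (I :: 'a fract set)" "I \<subseteq> base_ring"
    and M: "t_maximal M" and a: "a \<in> I" "a \<noteq> 0"
  shows "\<exists>s\<in>base_ring - M. \<exists>b\<in>I. \<exists>c\<in>I. \<exists>z. s * a = b * c * z \<and> (\<forall>i\<in>I. \<forall>j\<in>I. z * (i * j) \<in> I)"
proof -
  note subI = t_idealD(1)[OF I(1)]
  obtain b c where bc: "b \<in> I" "c \<in> I" "b \<noteq> 0" "c \<noteq> 0"
    "\<And>i j. i \<in> I \<Longrightarrow> j \<in> I \<Longrightarrow> a / (b * c) * (i * j) \<in> extension_at M I"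
    using pvmd_local_regular[OF pv M subI a] by blast
  define w where "w = a / (b * c)"
  define F where "F = {N. t_maximal N \<and> b * c \<in> N}"
  have bcR: "b * c \<in> base_ring" using bc I(2) by (auto intro: base_ring_mult)
  have "finite F" unfolding F_def by (rule finite_t_characterD[OF fin bcR]) (use bc in simp)
  have "\<exists>s\<in>base_ring - M. \<forall>i\<in>I. \<forall>j\<in>I. s * w * (i * j) \<in> extension_at N I" if "N \<in> F" for N
    using that bc(5) by (intro pvmd_transfer_colon[OF pv M _ subI]) (auto simp: F_def w_def)
  then obtain \<sigma> where \<sigma>: "\<And>N. N \<in> F \<Longrightarrow> \<sigma> N \<in> base_ring - M"
    "\<And>N i j. N \<in> F \<Longrightarrow> i \<in> I \<Longrightarrow> j \<in> I \<Longrightarrow> \<sigma> N * w * (i * j) \<in> extension_at N I" by metis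
  define s where "s = prod \<sigma> F"
  have s: "s \<in> base_ring - M"
    unfolding s_def by (rule t_maximal_complement_prod[OF M \<open>finite F\<close> \<sigma>(1)])
  have "s * w * (i * j) \<in> I" if ij: "i \<in> I" "j \<in> I" for i j
  proof (rule t_ideal_local[OF I(1)])
    fix N :: "'a fract set" assume N: "t_maximal N"
    have sup: "base_ring \<subseteq> extension_at N base_ring" by (rule extension_at_superset[OF N])
    show "s * w * (i * j) \<in> extension_at N I"
    proof (cases "N \<in> F")
      case True
      have "s = prod \<sigma> (F - {N}) * \<sigma> N"
        unfolding s_def using prod.remove[OF \<open>finite F\<close> True, of \<sigma>] by (simp add: mult.commute)
      moreover have "prod \<sigma> (F - {N}) \<in> base_ring" using \<sigma>(1) by (intro base_ring_prod) auto
      then have "prod \<sigma> (F - {N}) * (\<sigma> N * w * (i * j)) \<in> extension_at N I"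
        using sup by (intro extension_at_scale[OF N subI] \<sigma>(2)[OF True ij]) auto
      ultimately show ?thesis by (simp add: mult.assoc)
    next
      case False
      then have bcN: "b * c \<in> base_ring - N" using N bcR by (simp add: F_def)
      have "s * i * j \<in> base_ring" using s ij I(2) by (auto intro!: base_ring_mult)
      then have "s * i * j * a \<in> I" using a(1) by (rule subspace_mult[OF subI])
      moreover have "b * c * (s * w * (i * j)) = s * i * j * a"
        using bc(3,4) by (simp add: w_def field_simps)
      ultimately show ?thesis using bcN extension_atI by metis
    qed
  qed
  moreover have "s * a = b * c * (s * w)" using bc(3,4) by (simp add: w_def)
  ultimately show ?thesis using s bc(1,2) by blast
qed

text \<open>
Integrality of \<open>I\<close> puts \<open>1\<close> into this ideal, which is therefore nonzero; any nonzero \<open>a \<in> I\<close> gives the denominator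
\<open>a a\<close>.
\<close>

lemma t_ideal_square_colon:
  assumes I: "t_ideal I" "I \<subseteq> base_ring"
  shows "t_ideal {z. \<forall>i\<in>I. \<forall>j\<in>I. z * (i * j) \<in> I}" (is "t_ideal ?A")
  unfolding t_ideal_iff
proof (intro conjI allI impI)
  note subI = t_idealD(1)[OF I(1)]
  have sub: "fmod.subspace ?A"
    using subI by (intro subspace_intro)
      (auto simp: distrib_right mult.assoc fmod.subspace_0 fmod.subspace_add subspace_mult)
  obtain a where a: "a \<in> I" "a \<noteq> 0" using subspace_nonzero[OF subI t_idealD(3)[OF I(1)]] .
  show "fractional_ideal ?A"
  proof (rule fractional_idealI[OF sub, of "a * a"])
    show "a * a \<noteq> 0" using a(2) by simp
    show "a * a * x \<in> base_ring" if "x \<in> ?A" for x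
      using that a(1) I(2) by (auto simp: mult.commute)
  qed
  have "1 * (i * j) \<in> I" if "i \<in> I" "j \<in> I" for i j
    using subspace_mult[OF subI, of i j] that I(2) by auto
  then have "1 \<in> ?A" by blast
  then show "?A \<noteq> {0}" by (metis singletonD zero_neq_one)
  fix B assume B: "finite B" "B \<subseteq> ?A" "\<not> B \<subseteq> {0}"
  have "x * (i * j) \<in> I" if "x \<in> v_closure B" "i \<in> I" "j \<in> I" for x i j
    by (rule v_closure_multiples[OF I(1) B(1,3) that(1)]) (use B(2) that in blast)
  then show "v_closure B \<subseteq> ?A" by blast
qed

lemma finite_t_character_imp_clifford:
  assumes pv: "pvmd TYPE('a::idom)" and fin: "finite_t_character TYPE('a)"
  shows "clifford_t_regular TYPE('a)"
  unfolding clifford_t_regular_iff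
proof (intro allI impI)
  fix I\<^sub>0 :: "'a fract set" assume I\<^sub>0: "t_ideal I\<^sub>0"
  \<comment> \<open>The colon construction needs an integral ideal; the factor \<open>d\<close> is absorbed into \<open>A\<close> at the end.\<close>
  obtain d where d: "d \<noteq> 0" "\<And>x. x \<in> I\<^sub>0 \<Longrightarrow> d * x \<in> base_ring"
    using fractional_idealE[OF t_idealD(2)[OF I\<^sub>0]] by blast
  define I where "I = (*) d ` I\<^sub>0"
  have I: "t_ideal I" "I \<subseteq> base_ring"
    unfolding I_def using t_ideal_image_mult[OF I\<^sub>0 d(1)] d(2) by auto
  note subI = t_idealD(1)[OF I(1)]
  define A where "A = {z. \<forall>i\<in>I. \<forall>j\<in>I. z * (i * j) \<in> I}"
  have A: "t_ideal A" unfolding A_def by (rule t_ideal_square_colon[OF I])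
  let ?P = "ideal_prod (ideal_prod I I) A"
  have P: "fractional_ideal ?P" "?P \<noteq> {0}"
    using fractional_ideal_prod[OF t_ideal_prod(1)[OF I(1,1)] t_idealD(2)[OF A]]
      ideal_prod_nonzero[OF subspace_ideal_prod t_ideal_prod(2)[OF I(1,1)] t_idealD(1,3)[OF A]]
    by blast+
  have "t_closure ?P = I"
  proof
    have "?P \<subseteq> I" by (rule ideal_prod_induct2[OF subI]) (auto simp: A_def mult.commute)
    then show "t_closure ?P \<subseteq> I" using t_closure_mono t_idealD(4)[OF I(1)] by blast
    show "I \<subseteq> t_closure ?P"
    proof
      fix a assume a: "a \<in> I"
      show "a \<in> t_closure ?P"
      proof (rule t_closure_local[OF P])
        fix M :: "'a fract set" assume M: "t_maximal M"
        show "a \<in> extension_at M ?P"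
        proof (cases "a = 0")
          case True
          then show ?thesis
            using fmod.subspace_0[OF subspace_extension_at[OF M fractional_ideal_subspace[OF P(1)]]] by simp
        next
          case False
          obtain s b c z where s: "s \<in> base_ring - M" "b \<in> I" "c \<in> I" "s * a = b * c * z" "z \<in> A"
            using pvmd_finite_character_colon[OF pv fin I M a False] unfolding A_def by blast
          have "b * c * z \<in> ?P" by (intro ideal_prodI s)
          with s(1,4) show ?thesis using extension_atI by metis
        qed
      qed
    qed
  qed
  moreover have "?P = (*) d ` ideal_prod (ideal_prod I\<^sub>0 I\<^sub>0) ((*) d ` A)"
  proof -
    have "?P = (*) d ` (*) d ` ideal_prod (ideal_prod I\<^sub>0 I\<^sub>0) A"
      by (simp only: I_def ideal_prod_image_mult[OF d(1)] ideal_prod_commute[of I\<^sub>0 "(*) d ` I\<^sub>0"])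
    then show ?thesis
      by (simp only: ideal_prod_image_mult[OF d(1)] ideal_prod_commute[of "ideal_prod I\<^sub>0 I\<^sub>0"])
  qed
  ultimately have "(*) d ` t_closure (ideal_prod (ideal_prod I\<^sub>0 I\<^sub>0) ((*) d ` A)) = (*) d ` I\<^sub>0"
    by (simp only: I_def t_closure_image_mult[OF d(1)])
  then have "t_closure (ideal_prod (ideal_prod I\<^sub>0 I\<^sub>0) ((*) d ` A)) = I\<^sub>0"
    using image_mult_inverse(2)[OF d(1)] by metis
  then show "\<exists>A. t_ideal A \<and> t_closure (ideal_prod (ideal_prod I\<^sub>0 I\<^sub>0) A) = I\<^sub>0"
    using t_ideal_image_mult[OF A d(1)] by blast
qed

section \<open>Infinitely many pairwise comaximal finite sets\<close>

text \<open>
This is pure combinatorics of a family \<open>\<Omega>\<close> whose members can be separated by finite subsets. Call a finite set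
containing \<open>x\<close> good if some member of \<open>\<Omega>\<close> contains it. If some good set has no good extension lying in exactly one
member, it can be split again and again, and one half of each splitting is kept. Otherwise every good set extends to
one that determines a member of \<open>\<Omega>\<close>, and infinitely many members are so determined: given finitely many, and
a further \<open>M \<ni> x\<close>, choose an element of \<open>M\<close> outside each of them; a determining set that extends these choices
belongs to a new member.
\<close>

lemma separated_sequence:
  fixes \<Omega> :: "'b set set"
  assumes sep: "\<And>M N. M \<in> \<Omega> \<Longrightarrow> N \<in> \<Omega> \<Longrightarrow> M \<noteq> N \<Longrightarrow>
      \<exists>H K. finite H \<and> finite K \<and> H \<subseteq> M \<and> K \<subseteq> N \<and> (\<forall>L\<in>\<Omega>. \<not> H \<union> K \<subseteq> L)"
    and inf: "infinite {M \<in> \<Omega>. x \<in> M}"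
  obtains B :: "nat \<Rightarrow> 'b set"
  where "\<And>n. finite (B n)" "\<And>n. x \<in> B n" "\<And>n. \<exists>M\<in>\<Omega>. B n \<subseteq> M"
    "\<And>m n L. m \<noteq> n \<Longrightarrow> L \<in> \<Omega> \<Longrightarrow> \<not> B m \<union> B n \<subseteq> L"
proof -
  define good where "good C \<longleftrightarrow> finite C \<and> x \<in> C \<and> (\<exists>M\<in>\<Omega>. C \<subseteq> M)" for C
  define uni where "uni C \<longleftrightarrow> (\<exists>!M. M \<in> \<Omega> \<and> C \<subseteq> M)" for C
  show ?thesis
  proof (cases "\<exists>C\<^sub>0. good C\<^sub>0 \<and> (\<forall>C. good C \<longrightarrow> C\<^sub>0 \<subseteq> C \<longrightarrow> \<not> uni C)")
    case True
    then obtain C\<^sub>0 where C\<^sub>0: "good C\<^sub>0" "\<And>C. good C \<Longrightarrow> C\<^sub>0 \<subseteq> C \<Longrightarrow> \<not> uni C" by blast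
    have split: "\<exists>C1 C2. good C1 \<and> good C2 \<and> C \<subseteq> C1 \<and> C \<subseteq> C2 \<and> (\<forall>L\<in>\<Omega>. \<not> C1 \<union> C2 \<subseteq> L)"
      if C: "good C \<and> C\<^sub>0 \<subseteq> C" for C
    proof -
      obtain M where M: "M \<in> \<Omega>" "C \<subseteq> M" using C by (auto simp: good_def)
      obtain N where N: "N \<in> \<Omega>" "C \<subseteq> N" "M \<noteq> N"
        using C\<^sub>0(2)[of C] C M unfolding uni_def by blast
      obtain H K where HK: "finite H" "finite K" "H \<subseteq> M" "K \<subseteq> N" "\<forall>L\<in>\<Omega>. \<not> H \<union> K \<subseteq> L"
        using sep[OF M(1) N(1,3)] by blast
      have "good (C \<union> H)" "good (C \<union> K)" using C M N HK by (auto simp: good_def)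
      moreover have "\<forall>L\<in>\<Omega>. \<not> (C \<union> H) \<union> (C \<union> K) \<subseteq> L" using HK(5) by blast
      ultimately have "good (C \<union> H) \<and> good (C \<union> K) \<and> C \<subseteq> C \<union> H \<and> C \<subseteq> C \<union> K \<and>
          (\<forall>L\<in>\<Omega>. \<not> (C \<union> H) \<union> (C \<union> K) \<subseteq> L)"
        by (intro conjI Un_upper1)
      then show ?thesis by (rule exI[of _ "C \<union> H", OF exI[of _ "C \<union> K"]])
    qed
    then obtain l r where lr: "\<And>C. good C \<and> C\<^sub>0 \<subseteq> C \<Longrightarrow> good (l C) \<and> good (r C) \<and> C \<subseteq> l C \<and> C \<subseteq> r C \<and>
        (\<forall>L\<in>\<Omega>. \<not> l C \<union> r C \<subseteq> L)" by metis
    define c where "c n = (r ^^ n) C\<^sub>0" for n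
    have c: "good (c n) \<and> C\<^sub>0 \<subseteq> c n" for n
    proof (induction n)
      case 0
      then show ?case using C\<^sub>0(1) by (simp add: c_def)
    next
      case (Suc n)
      then show ?case using lr[of "c n"] by (auto simp: c_def)
    qed
    have "c n \<subseteq> c (Suc n)" for n using lr[OF c[of n]] by (simp add: c_def)
    then have mono: "m \<le> n \<Longrightarrow> c m \<subseteq> c n" for m n by (rule lift_Suc_mono_le)
    \<comment> \<open>All later sets extend \<open>r (c m)\<close>, the half that is separated from \<open>l (c m)\<close>.\<close>
    have ordered: "\<not> l (c m) \<union> l (c n) \<subseteq> L" if "m < n" "L \<in> \<Omega>" for m n L
    proof -
      have "r (c m) = c (Suc m)" by (simp add: c_def)
      also have "\<dots> \<subseteq> c n" using that(1) by (intro mono) simp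
      also have "\<dots> \<subseteq> l (c n)" using lr[OF c[of n]] by blast
      finally show ?thesis using lr[OF c[of m]] that(2) by blast
    qed
    show ?thesis
    proof (rule that[of "\<lambda>n. l (c n)"])
      show "finite (l (c n))" "x \<in> l (c n)" "\<exists>M\<in>\<Omega>. l (c n) \<subseteq> M" for n
        using lr[OF c[of n]] by (auto simp: good_def)
      show "\<not> l (c m) \<union> l (c n) \<subseteq> L" if "m \<noteq> n" "L \<in> \<Omega>" for m n L
        using that ordered[of m n L] ordered[of n m L] by (metis linorder_neqE_nat sup_commute)
    qed
  next
    case False
    define U where "U = {M \<in> \<Omega>. \<exists>C. good C \<and> uni C \<and> C \<subseteq> M}"
    have "infinite U"
    proof
      assume U: "finite U"
      have "\<not> {M \<in> \<Omega>. x \<in> M} \<subseteq> U" using U inf finite_subset by blast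
      then obtain M where M: "M \<in> \<Omega>" "x \<in> M" "M \<notin> U" by blast
      have "\<exists>b. b \<in> M \<and> b \<notin> N" if "N \<in> U" for N
      proof (rule ccontr)
        assume "\<not> (\<exists>b. b \<in> M \<and> b \<notin> N)"
        then have "M \<subseteq> N" by blast
        then show False using sep[OF M(1), of N] that M(3) by (auto simp: U_def)
      qed
      then obtain b where b: "\<And>N. N \<in> U \<Longrightarrow> b N \<in> M \<and> b N \<notin> N" by metis
      have "good (insert x (b ` U))" using U M b by (auto simp: good_def)
      then obtain C where C: "good C" "insert x (b ` U) \<subseteq> C" "uni C" using False by blast
      then obtain N where "N \<in> \<Omega>" "C \<subseteq> N" by (auto simp: good_def)
      then have "N \<in> U" "b ` U \<subseteq> N" using C by (auto simp: U_def)
      then show False using b by blast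
    qed
    then obtain e :: "nat \<Rightarrow> 'b set" where e: "inj e" "range e \<subseteq> U"
      using infinite_countable_subset by blast
    then have "\<forall>n. \<exists>C. good C \<and> uni C \<and> C \<subseteq> e n \<and> e n \<in> \<Omega>" by (auto simp: U_def)
    then obtain B where B: "\<And>n. good (B n) \<and> uni (B n) \<and> B n \<subseteq> e n \<and> e n \<in> \<Omega>" by metis
    have uniD: "uni C \<Longrightarrow> M \<in> \<Omega> \<Longrightarrow> C \<subseteq> M \<Longrightarrow> N \<in> \<Omega> \<Longrightarrow> C \<subseteq> N \<Longrightarrow> M = N" for C M N
      unfolding uni_def by blast
    show ?thesis
    proof (rule that[of B])
      show "finite (B n)" "x \<in> B n" "\<exists>M\<in>\<Omega>. B n \<subseteq> M" for n using B[of n] by (auto simp: good_def)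
      show "\<not> B m \<union> B n \<subseteq> L" if "m \<noteq> n" "L \<in> \<Omega>" for m n L
      proof
        assume "B m \<union> B n \<subseteq> L"
        then have "B m \<subseteq> L" "B n \<subseteq> L" by auto
        then have "L = e m" "L = e n"
          using uniD[OF _ that(2), of "B m" "e m"] uniD[OF _ that(2), of "B n" "e n"] B[of m] B[of n]
          by simp_all
        then show False using e(1) that(1) by (auto dest: injD)
      qed
    qed
  qed
qed

section \<open>Clifford t-regularity implies finite t-character\<close>

lemma finite_subset_incseq_Union:
  fixes D :: "nat \<Rightarrow> 'b set"
  assumes "incseq D" "finite C" "C \<subseteq> (\<Union>n. D n)"
  shows "\<exists>n. C \<subseteq> D n"
  using assms(2,3)
proof (induction C rule: finite_induct)
  case (insert c C)
  then obtain m n where "C \<subseteq> D m" "c \<in> D n" by auto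
  moreover have "D m \<subseteq> D (max m n)" "D n \<subseteq> D (max m n)"
    by (rule incseqD[OF assms(1)]; simp)+
  ultimately show ?case by blast
qed simp

lemma subspace_incseq_Union:
  assumes "incseq D" "\<And>n. fmod.subspace (D n)"
  shows "fmod.subspace (\<Union>n. D n)"
proof (rule subspace_intro)
  show "0 \<in> (\<Union>n. D n)" using fmod.subspace_0[OF assms(2)] by blast
  show "r * x \<in> (\<Union>n. D n)" if "r \<in> base_ring" "x \<in> (\<Union>n. D n)" for r x
    using that subspace_mult[OF assms(2)] by blast
  fix x y assume "x \<in> (\<Union>n. D n)" "y \<in> (\<Union>n. D n)"
  then obtain n where "{x, y} \<subseteq> D n" using finite_subset_incseq_Union[OF assms(1), of "{x, y}"] by auto
  then have "x + y \<in> D n" by (intro fmod.subspace_add[OF assms(2)]) auto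
  then show "x + y \<in> (\<Union>n. D n)" by blast
qed

text \<open>
Finitely many conditions at \<open>M\<close> have a common denominator. Hence submodules that are defined by membership of multiples in
localizations \<open>R\<^sub>M\<close> absorb divisorial closures of their finite subsets.
\<close>

lemma v_closure_multiples_local:
  assumes M: "t_maximal M" and "finite B" "y \<in> v_closure B"
    and "\<And>b. b \<in> B \<Longrightarrow> b * w \<in> extension_at M base_ring"
  shows "y * w \<in> extension_at M base_ring"
proof -
  have "\<forall>b\<in>B. \<exists>s\<in>base_ring - M. s * (b * w) \<in> base_ring"
    using assms(4) by (auto simp: extension_at_def)
  then obtain \<sigma> where \<sigma>: "\<And>b. b \<in> B \<Longrightarrow> \<sigma> b \<in> base_ring - M \<and> \<sigma> b * (b * w) \<in> base_ring" by metis
  have s: "prod \<sigma> B \<in> base_ring - M" by (rule t_maximal_complement_prod[OF M assms(2)]) (use \<sigma> in blast)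
  have "prod \<sigma> B * w * y \<in> base_ring"
  proof (rule v_closure_bound[OF assms(3)])
    fix b assume b: "b \<in> B"
    have "prod \<sigma> B = prod \<sigma> (B - {b}) * \<sigma> b"
      using prod.remove[OF assms(2) b, of \<sigma>] by (simp add: mult.commute)
    moreover have "prod \<sigma> (B - {b}) \<in> base_ring" by (rule base_ring_prod) (use \<sigma> in blast)
    then have "prod \<sigma> (B - {b}) * (\<sigma> b * (b * w)) \<in> base_ring"
      by (rule base_ring_mult) (use \<sigma>[OF b] in blast)
    ultimately show "prod \<sigma> B * w * b \<in> base_ring" by (simp add: mult_ac)
  qed
  then have "prod \<sigma> B * (y * w) \<in> base_ring" by (simp add: mult_ac)
  then show ?thesis by (rule extension_atI[OF s])
qed

text \<open>
If \<open>J R\<^sub>M = j R\<^sub>M\<close>, then the equation \<open>J J A = J\<close> at \<open>M\<close> can be divided by \<open>j\<close> and becomes \<open>J A = R\<close> at \<open>M\<close>.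
\<close>

lemma locally_principal_t_invertible:
  assumes pv: "pvmd TYPE('a::idom)" and J: "t_ideal (J :: 'a fract set)" and A: "t_ideal A"
    and regular: "t_closure (ideal_prod (ideal_prod J J) A) = J"
    and principal: "\<And>M. t_maximal M \<Longrightarrow> \<exists>j\<in>J. j \<noteq> 0 \<and> (\<forall>y\<in>J. y / j \<in> extension_at M base_ring)"
  shows "ideal_prod J A \<subseteq> base_ring" "1 \<in> t_closure (ideal_prod J A)"
proof -
  let ?P = "ideal_prod (ideal_prod J J) A"
  have P: "fractional_ideal ?P" "?P \<noteq> {0}"
    using fractional_ideal_prod[OF t_ideal_prod(1)[OF J J] t_idealD(2)[OF A]]
      ideal_prod_nonzero[OF subspace_ideal_prod t_ideal_prod(2)[OF J J] t_idealD(1,3)[OF A]]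
    by blast+
  have PJ: "?P \<subseteq> J" using t_closure_extensive[OF P] regular by simp
  have "y * a \<in> base_ring" if "y \<in> J" "a \<in> A" for y a
  proof (rule t_ideal_local[OF t_ideal_base_ring])
    fix M :: "'a fract set" assume "t_maximal M"
    then obtain j where j: "j \<in> J" "j \<noteq> 0" "\<forall>y\<in>J. y / j \<in> extension_at M base_ring"
      using principal by blast
    have "y * j * a \<in> J" using PJ ideal_prodI[OF ideal_prodI[OF that(1) j(1)] that(2)] by blast
    then have "y * j * a / j \<in> extension_at M base_ring" using j(3) by blast
    then show "y * a \<in> extension_at M base_ring" using j(2) by simp
  qed
  then show "ideal_prod J A \<subseteq> base_ring" using ideal_prod_subset_iff[OF subspace_base_ring] by blast
  show "1 \<in> t_closure (ideal_prod J A)"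
  proof (rule t_closure_local[OF t_ideal_prod[OF J A]])
    fix M :: "'a fract set" assume M: "t_maximal M"
    then obtain j where j: "j \<in> J" "j \<noteq> 0" "\<forall>y\<in>J. y / j \<in> extension_at M base_ring"
      using principal by blast
    note subE = subspace_extension_at[OF M subspace_ideal_prod, of J A]
    have "?P \<subseteq> {p. p / j \<in> extension_at M (ideal_prod J A)}"
    proof (rule ideal_prod_induct2)
      show "fmod.subspace {p. p / j \<in> extension_at M (ideal_prod J A)}"
        by (rule subspace_intro)
          (use fmod.subspace_0[OF subE] fmod.subspace_add[OF subE] subspace_mult[OF subE] in
            \<open>auto simp: add_divide_distrib times_divide_eq_right[symmetric]
              simp del: times_divide_eq_right\<close>)
      fix y y' a assume "y \<in> J" "y' \<in> J" "a \<in> A"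
      then have "y / j \<in> extension_at M base_ring" "y' * a \<in> extension_at M (ideal_prod J A)"
        using j(3) extension_at_superset[OF M] ideal_prodI[of y' J a A] by blast+
      then have "y / j * (y' * a) \<in> extension_at M (ideal_prod J A)"
        by (rule extension_at_scale[OF M subspace_ideal_prod])
      then show "y * y' * a \<in> {p. p / j \<in> extension_at M (ideal_prod J A)}" by (simp add: mult.assoc)
    qed
    moreover have "j \<in> extension_at M ?P"
      using j(1) regular t_closure_subset_extension_at[OF pv M P(1)] by blast
    then obtain s where s: "s \<in> base_ring - M" "s * j \<in> ?P" by (auto simp: extension_at_def)
    ultimately have "s * j / j \<in> extension_at M (ideal_prod J A)" by blast
    then have "s * 1 \<in> extension_at M (ideal_prod J A)" using j(2) by simp
    then show "1 \<in> extension_at M (ideal_prod J A)" by (rule extension_at_cancel[OF M s(1)])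
  qed
qed

text \<open>
The union \<open>J\<close> of the chain \<open>D\<close> is a locally principal t-ideal, so \<open>(J A)\<^sub>t = R\<close> for some \<open>A\<close> with \<open>J A \<subseteq> R\<close>. By
finiteness \<open>1 \<in> (D n A)\<^sub>t\<close> for some \<open>n\<close>. At a t-maximal ideal \<open>M\<close> containing \<open>B n\<close> this fails: there \<open>D n\<close> is
generated by \<open>x\<close>, but \<open>J\<close> by \<open>x / f\<close> for some \<open>f \<in> M\<close>, so \<open>D n A\<close> is contained in \<open>f R\<^sub>M\<close>.
\<close>

lemma clifford_imp_finite_t_character:
  assumes pv: "pvmd TYPE('a::idom)" and cl: "clifford_t_regular TYPE('a)"
  shows "finite_t_character TYPE('a)"
  unfolding finite_t_character_def
proof (intro allI impI, elim conjE, rule ccontr)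
  fix a :: 'a assume "a \<noteq> 0" and inf: "infinite {M. t_maximal M \<and> to_fract a \<in> M}"
  define x where "x = to_fract a"
  have x: "x \<in> base_ring" "x \<noteq> 0" using \<open>a \<noteq> 0\<close> by (auto simp: x_def base_ring_def)
  have sep: "\<exists>H K. finite H \<and> finite K \<and> H \<subseteq> M \<and> K \<subseteq> N \<and> (\<forall>L\<in>Collect t_maximal. \<not> H \<union> K \<subseteq> L)"
    if "M \<in> Collect t_maximal" "N \<in> Collect t_maximal" "M \<noteq> N" for M N :: "'a fract set"
    using t_maximal_comaximal[of M N] that by simp
  have "infinite {M \<in> Collect t_maximal. x \<in> M}" using inf by (simp add: x_def)
  then obtain B :: "nat \<Rightarrow> 'a fract set" where B: "\<And>n. finite (B n)" "\<And>n. x \<in> B n"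
    "\<And>n. \<exists>M\<in>Collect t_maximal. B n \<subseteq> M"
    and comax: "\<And>m n L. m \<noteq> n \<Longrightarrow> L \<in> Collect t_maximal \<Longrightarrow> \<not> B m \<union> B n \<subseteq> L"
    using separated_sequence[of "Collect t_maximal" x, OF sep] by blast
  have BR: "b \<in> base_ring" if "b \<in> B n" for b n
    using B(3)[of n] that t_maximalD(2) by blast
  have unique: "k = l" if "t_maximal M" "B k \<subseteq> M" "B l \<subseteq> M" for M k l
    using comax[of k l M] that by auto
  \<comment> \<open>The t-ideal \<open>D n\<close> is prescribed by its localizations: \<open>(x : B k)\<close> where \<open>M\<close> contains some \<open>B k\<close>
    with \<open>k < n\<close>, and \<open>(x)\<close> elsewhere. The first includes the second, as \<open>B k\<close> is integral.\<close>
  define D where "D n = {y. \<forall>M. t_maximal M \<longrightarrow> y * (1 / x) \<in> extension_at M base_ring \<or>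
      (\<exists>k<n. B k \<subseteq> M \<and> (\<forall>b\<in>B k. y * (b / x) \<in> extension_at M base_ring))}" for n
  have D_in: "y * (b / x) \<in> extension_at M base_ring"
    if asm: "y \<in> D n" "t_maximal M" "B k \<subseteq> M" "b \<in> B k" for y n M k b
  proof -
    consider "y * (1 / x) \<in> extension_at M base_ring"
      | l where "B l \<subseteq> M" "\<forall>b\<in>B l. y * (b / x) \<in> extension_at M base_ring"
      using asm(1,2) unfolding D_def by blast
    then show ?thesis
    proof cases
      case 1
      then have "b * (y * (1 / x)) \<in> extension_at M base_ring"
        by (rule subspace_mult[OF subspace_extension_at[OF that(2) subspace_base_ring] BR[OF that(4)]])
      then show ?thesis by (simp add: mult.commute)
    next
      case 2
      then show ?thesis using unique[OF that(2,3) 2(1)] that(4) by blast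
    qed
  qed
  have D_out: "y * (1 / x) \<in> extension_at M base_ring"
    if "y \<in> D n" "t_maximal M" "\<And>k. k < n \<Longrightarrow> \<not> B k \<subseteq> M" for y n M
    using that unfolding D_def by blast
  have D_mono: "incseq D"
    by (rule incseq_SucI) (auto simp: D_def less_Suc_eq)
  have D_v: "v_closure C \<subseteq> D n" if C: "finite C" "C \<subseteq> D n" for C n
  proof
    fix y assume y: "y \<in> v_closure C"
    show "y \<in> D n"
      unfolding D_def
    proof (intro CollectI allI impI)
      fix M :: "'a fract set" assume M: "t_maximal M"
      note v_local = v_closure_multiples_local[OF M C(1) y]
      show "y * (1 / x) \<in> extension_at M base_ring \<or>
        (\<exists>k<n. B k \<subseteq> M \<and> (\<forall>b\<in>B k. y * (b / x) \<in> extension_at M base_ring))"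
      proof (cases "\<exists>k<n. B k \<subseteq> M")
        case True
        then obtain k where k: "k < n" "B k \<subseteq> M" by blast
        have "y * (b / x) \<in> extension_at M base_ring" if "b \<in> B k" for b
          by (rule v_local) (use C(2) D_in[OF _ M k(2) that] in blast)
        then show ?thesis using k by blast
      next
        case False
        have "y * (1 / x) \<in> extension_at M base_ring"
          by (rule v_local) (use C(2) D_out[OF _ M] False in blast)
        then show ?thesis by blast
      qed
    qed
  qed
  have D_sub: "fmod.subspace (D n)" for n
  proof (rule subspace_intro)
    show "0 \<in> D n"
      using extension_at_superset[of _ base_ring] by (fastforce simp: D_def)
    show "u + v \<in> D n" if "u \<in> D n" "v \<in> D n" for u v
      using D_v[of "{u, v}" n] that v_closure_extensive[of "{u, v}"]
        fmod.subspace_add[OF subspace_v_closure[of "{u, v}"], of u v] by auto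
    show "r * u \<in> D n" if "r \<in> base_ring" "u \<in> D n" for r u
      using D_v[of "{u}" n] that v_closure_extensive[of "{u}"]
        subspace_mult[OF subspace_v_closure[of "{u}"] that(1), of u] by auto
  qed
  define J where "J = (\<Union>n. D n)"
  have J_sub: "fmod.subspace J" unfolding J_def by (rule subspace_incseq_Union[OF D_mono D_sub])
  have J_int: "J \<subseteq> base_ring"
  proof
    fix y assume "y \<in> J"
    then obtain n where y: "y \<in> D n" by (auto simp: J_def)
    show "y \<in> base_ring"
    proof (rule t_ideal_local[OF t_ideal_base_ring])
      fix M :: "'a fract set" assume M: "t_maximal M"
      show "y \<in> extension_at M base_ring"
      proof (cases "\<exists>k<n. B k \<subseteq> M")
        case True
        then obtain k where "B k \<subseteq> M" by blast
        then show ?thesis using D_in[OF y M _ B(2)] x(2) by simp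
      next
        case False
        then have "x * (y * (1 / x)) \<in> extension_at M base_ring"
          using D_out[OF y M] subspace_mult[OF subspace_extension_at[OF M subspace_base_ring] x(1)] by blast
        then show ?thesis using x(2) by simp
      qed
    qed
  qed
  have xD: "x \<in> D n" for n
    using extension_at_superset[of _ base_ring] x(2) by (fastforce simp: D_def)
  have J: "t_ideal J"
    unfolding t_ideal_iff
  proof (intro conjI allI impI)
    show "fractional_ideal J" by (rule fractional_idealI[OF J_sub, of 1]) (use J_int in auto)
    show "J \<noteq> {0}" using xD x(2) unfolding J_def by blast
    fix C assume "finite C" "C \<subseteq> J"
    moreover from this obtain n where "C \<subseteq> D n"
      unfolding J_def using finite_subset_incseq_Union[OF D_mono] by blast
    ultimately show "v_closure C \<subseteq> J" using D_v unfolding J_def by blast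
  qed
  \<comment> \<open>If \<open>f\<close> generates \<open>B k\<close> at \<open>M\<close>, then \<open>x / f\<close> generates \<open>(x : B k)\<close> there; the factor \<open>s\<close> makes it an
    element of \<open>J\<close>.\<close>
  have gen: "\<exists>f\<in>B k. f \<noteq> 0 \<and> (\<exists>s\<in>base_ring - M. s * x / f \<in> J)"
    if M: "t_maximal M" for M k
  proof -
    have "\<not> B k \<subseteq> {0}" using B(2) x(2) by blast
    then obtain f s where f: "f \<in> B k" "f \<noteq> 0" "s \<in> base_ring - M" "\<forall>b\<in>B k. s * (b / f) \<in> base_ring"
      using pvmd_local_generator[OF pv M B(1)] by blast
    have "s * x / f \<in> D (Suc k)"
      unfolding D_def
    proof (intro CollectI allI impI)
      fix N :: "'a fract set" assume N: "t_maximal N"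
      note sup = extension_at_superset[OF N, of base_ring]
      show "s * x / f * (1 / x) \<in> extension_at N base_ring \<or>
          (\<exists>l<Suc k. B l \<subseteq> N \<and> (\<forall>b\<in>B l. s * x / f * (b / x) \<in> extension_at N base_ring))"
      proof (cases "B k \<subseteq> N")
        case True
        have "s * x / f * (b / x) \<in> extension_at N base_ring" if "b \<in> B k" for b
          using f(4) that sup x(2) by auto
        then show ?thesis using True by blast
      next
        case False
        then obtain g where g: "g \<in> B k" "g \<notin> N" by blast
        have "g * (s * x / f * (1 / x)) = s * (g / f)" using x(2) by simp
        also have "\<dots> \<in> base_ring" using f(4) g(1) by blast
        finally show ?thesis using extension_atI[of g N] BR g by blast
      qed
    qed
    then show ?thesis using f(1-3) unfolding J_def by blast
  qed
  have principal: "\<exists>j\<in>J. j \<noteq> 0 \<and> (\<forall>y\<in>J. y / j \<in> extension_at M base_ring)" if M: "t_maximal M" for M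
  proof (cases "\<exists>k. B k \<subseteq> M")
    case True
    then obtain k where k: "B k \<subseteq> M" by blast
    obtain f s where f: "f \<in> B k" "f \<noteq> 0" "s \<in> base_ring - M" "s * x / f \<in> J" using gen[OF M] by blast
    have s0: "s \<noteq> 0" using f(3) t_maximalD(4)[OF M] by auto
    have "y / (s * x / f) \<in> extension_at M base_ring" if "y \<in> J" for y
    proof (rule extension_at_cancel[OF M f(3)])
      have "y * (f / x) \<in> extension_at M base_ring" using that D_in[OF _ M k f(1)] unfolding J_def by blast
      then show "s * (y / (s * x / f)) \<in> extension_at M base_ring" using s0 by simp
    qed
    moreover have "s * x / f \<noteq> 0" using s0 f(2) x(2) by simp
    ultimately show ?thesis using f(4) by blast
  next
    case False
    have "y / x \<in> extension_at M base_ring" if "y \<in> J" for y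
      using that D_out[OF _ M] False unfolding J_def by auto
    then show ?thesis using xD x(2) unfolding J_def by blast
  qed
  obtain A where A: "t_ideal A" "t_closure (ideal_prod (ideal_prod J J) A) = J"
    using cl J unfolding clifford_t_regular_iff by blast
  note JA = locally_principal_t_invertible[OF pv J A principal]
  obtain H where H: "finite H" "H \<subseteq> ideal_prod J A" "\<not> H \<subseteq> {0}" "1 \<in> v_closure H"
    using JA(2) unfolding t_closure_iff[OF t_ideal_prod(1)[OF J A(1)]] by blast
  have incP: "incseq (\<lambda>n. ideal_prod (D n) A)"
    by (rule incseq_SucI) (intro ideal_prod_mono incseq_SucD[OF D_mono] subset_refl)
  have "ideal_prod J A \<subseteq> (\<Union>n. ideal_prod (D n) A)"
    unfolding ideal_prod_subset_iff[OF subspace_incseq_Union[OF incP subspace_ideal_prod]]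
    by (auto simp: J_def intro: ideal_prodI)
  then obtain n where n: "H \<subseteq> ideal_prod (D n) A"
    using finite_subset_incseq_Union[OF incP H(1)] H(2) by blast
  have DJ: "ideal_prod (D n) A \<subseteq> ideal_prod J A" by (rule ideal_prod_mono) (auto simp: J_def)
  have frac: "fractional_ideal (ideal_prod (D n) A)"
    by (rule fractional_idealI[OF subspace_ideal_prod, of 1]) (use DJ JA(1) in auto)
  obtain M where M: "t_maximal M" "B n \<subseteq> M" using B(3)[of n] by blast
  have "1 \<in> t_closure (ideal_prod (D n) A)" unfolding t_closure_iff[OF frac] using H n by blast
  then have 1: "1 \<in> extension_at M (ideal_prod (D n) A)"
    using t_closure_subset_extension_at[OF pv M(1) frac] by blast
  obtain f s where f: "f \<in> B n" "f \<noteq> 0" "s \<in> base_ring - M" "s * x / f \<in> J" using gen[OF M(1)] by blast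
  \<comment> \<open>At \<open>M\<close> an element \<open>y \<in> D n\<close> is a multiple of \<open>x = f (x / f)\<close>, and \<open>(x / f) A \<subseteq> R\<^sub>M\<close> because \<open>J A \<subseteq> R\<close>.\<close>
  have "ideal_prod (D n) A \<subseteq> extension_at M M"
    unfolding ideal_prod_subset_iff[OF subspace_extension_at[OF M(1) t_maximalD(5)[OF M(1)]]]
  proof (intro ballI)
    fix y z assume y: "y \<in> D n" and z: "z \<in> A"
    have "y * (1 / x) \<in> extension_at M base_ring"
      using unique[OF M(1) _ M(2)] by (intro D_out[OF y M(1)]) blast
    moreover have "s * x / f * z \<in> base_ring" using JA(1) ideal_prodI[OF f(4) z] by blast
    then have "s * x / f * z * f \<in> M" using f(1) M(2) by (intro subspace_mult[OF t_maximalD(5)[OF M(1)]]) auto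
    then have "s * x / f * z * f \<in> extension_at M M" using extension_at_superset[OF M(1)] by blast
    ultimately have "y * (1 / x) * (s * x / f * z * f) \<in> extension_at M M"
      by (rule extension_at_scale[OF M(1) t_maximalD(5)[OF M(1)]])
    moreover have "y * (1 / x) * (s * x / f * z * f) = s * (y * z)" using x(2) f(2) by simp
    ultimately show "y * z \<in> extension_at M M" using extension_at_cancel[OF M(1) f(3)] by simp
  qed
  moreover obtain t where t: "t \<in> base_ring - M" "t * 1 \<in> ideal_prod (D n) A"
    using 1 by (auto simp: extension_at_def)
  ultimately have "t \<in> extension_at M M" by auto
  then obtain u where "u \<in> base_ring - M" "u * t \<in> M" by (auto simp: extension_at_def)
  then show False using t_maximal_complement_mult[OF M(1) _ t(1)] by blast
qed

theorem theorem3p2: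
  assumes "pvmd TYPE('a::idom)"
  shows "clifford_t_regular TYPE('a) \<longleftrightarrow> krull_type_domain TYPE('a)"
  using assms clifford_imp_finite_t_character finite_t_character_imp_clifford
  unfolding krull_type_domain_def by blast

end
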